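(* The IB termination problem is decidable for FIFO machines: given a FIFO machine $M=(Q,\mathit{Ch},\Sigma,\Delta,q_0)$ and a tuple $(L_c)_{c\in\mathit{Ch}}$ of non-empty regular bounded languages $L_c\subseteq\Sigma_c^\ast$, it is decidable whether there is no infinite execution $s_0\xrightarrow{\beta_1}s_1\xrightarrow{\beta_2}s_2\xrightarrow{\beta_3}\cdots$ from the initial configuration $s_0$ with $\beta_i\in A_M$ and $\beta_1\cdots\beta_i\in\mathrm{Pref}(L_!)$ for all $i$.
   Context: A bounded language over non-empty words $(w_1,\ldots,w_n)$ is a language $L\subseteq w_1^\ast\cdots w_n^\ast$. A FIFO machine is $M=(Q,\mathit{Ch},\Sigma,\Delta,q_0)$ with finite control states $Q$, initial state $q_0$, finite channels $\mathit{Ch}$, alphabet $\Sigma=\biguplus_c\Sigma_c$, and $\Delta\subseteq Q\times A_M\times Q$, $A_M=\{c!a,c?a\mid c\in\mathit{Ch},a\in\Sigma_c\}$. Configurations $(q,\mathbf{w})$ with $\mathbf{w}\in\prod_c\Sigma_c^\ast$; initial $(q_0,(\varepsilon)_c)$. A send $c!a$ appends $a$ to channel $c$; a receive $c?a$ removes $a$ from the head of channel $c$ (only possible if $a$ is at the head); other channels unchanged; the control state moves along a transition of $\Delta$. $L_!=\{\sigma\in A_M^\ast\mid\mathrm{proj}_{c!}(\sigma)\in L_c\ \forall c\}$, where $\mathrm{proj}_{c!}$ keeps the messages of send actions on $c$ and erases all other actions. $\mathrm{Pref}(L)$ is the set of prefixes of words in $L$. *)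

theory Defs
  imports Main "HOL-Library.Nat_Bijection"
begin

datatype recf = RZ | RS | RProj nat | RComp recf "recf list" | RPrim recf recf | RMn recf

inductive rec_eval :: "recf \<Rightarrow> nat list \<Rightarrow> nat \<Rightarrow> bool" where
  ev_Z: "rec_eval RZ xs 0"
| ev_S: "rec_eval RS (x # xs) (Suc x)"
| ev_Proj: "i < length xs \<Longrightarrow> rec_eval (RProj i) xs (xs ! i)"
| ev_Comp: "list_all2 (\<lambda>g y. rec_eval g xs y) gs ys \<Longrightarrow> rec_eval f ys z
            \<Longrightarrow> rec_eval (RComp f gs) xs z"
| ev_Prim0: "rec_eval f xs y \<Longrightarrow> rec_eval (RPrim f g) (0 # xs) y"
| ev_PrimS: "rec_eval (RPrim f g) (n # xs) y \<Longrightarrow> rec_eval g (n # y # xs) z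
            \<Longrightarrow> rec_eval (RPrim f g) (Suc n # xs) z"
| ev_Mn: "rec_eval f (n # xs) 0 \<Longrightarrow> (\<forall>m<n. \<exists>y. rec_eval f (m # xs) y \<and> 0 < y)
            \<Longrightarrow> rec_eval (RMn f) xs n"

definition decidable_on :: "('i \<Rightarrow> nat) \<Rightarrow> ('i \<Rightarrow> bool) \<Rightarrow> ('i \<Rightarrow> bool) \<Rightarrow> bool" where
  "decidable_on enc D P \<longleftrightarrow>
     (\<exists>f. \<forall>x. D x \<longrightarrow> rec_eval f [enc x] (if P x then 1 else 0))"

definition Pref :: "'a list set \<Rightarrow> 'a list set" where
  "Pref L = {u. \<exists>v. u @ v \<in> L}"

definition bounded_by :: "'a list list \<Rightarrow> 'a list set" where
  "bounded_by ws = {concat (map2 (\<lambda>w k. concat (replicate k w)) ws ks) | ks.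
                      length ks = length ws}"

definition bounded_lang :: "'a list set \<Rightarrow> bool" where
  "bounded_lang L \<longleftrightarrow> (\<exists>ws. (\<forall>w\<in>set ws. w \<noteq> []) \<and> L \<subseteq> bounded_by ws)"

text \<open>An NFA over states and letters in nat: (initial states, final states, transitions).\<close>
type_synonym nfa = "nat list \<times> nat list \<times> (nat \<times> nat \<times> nat) list"

fun nfa_reach :: "(nat \<times> nat \<times> nat) list \<Rightarrow> nat \<Rightarrow> nat list \<Rightarrow> nat \<Rightarrow> bool" where
  "nfa_reach T p [] q = (p = q)"
| "nfa_reach T p (a # w) q = (\<exists>p'. (p, a, p') \<in> set T \<and> nfa_reach T p' w q)"

definition nfa_lang :: "nfa \<Rightarrow> nat list set" where
  "nfa_lang A = (case A of (I, F, T) \<Rightarrow>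
     {w. \<exists>p\<in>set I. \<exists>q\<in>set F. nfa_reach T p w q})"

datatype act = Snd nat nat | Rcv nat nat  \<comment> \<open>c!a and c?a (channel, message)\<close>

text \<open>An instance of the IB termination problem: a FIFO machine with finite state list,
  channel list, per-channel alphabets (pairs (c,a) meaning a \<in> \<Sigma>_c), transitions,
  initial state, and for every channel an NFA describing the regular language L_c.\<close>
record fifo_inst =
  states :: "nat list"
  chans :: "nat list"
  alph :: "(nat \<times> nat) list"
  delta :: "(nat \<times> act \<times> nat) list"
  init :: nat
  auts :: "(nat \<times> nfa) list"

definition Sigma_c :: "fifo_inst \<Rightarrow> nat \<Rightarrow> nat set" where
  "Sigma_c M c = {a. (c, a) \<in> set (alph M)}"

definition actions :: "fifo_inst \<Rightarrow> act set" where
  "actions M = {Snd c a | c a. c \<in> set (chans M) \<and> a \<in> Sigma_c M c}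
             \<union> {Rcv c a | c a. c \<in> set (chans M) \<and> a \<in> Sigma_c M c}"

definition L_c :: "fifo_inst \<Rightarrow> nat \<Rightarrow> nat list set" where
  "L_c M c = nfa_lang (the (map_of (auts M) c))"

fun proj_send :: "nat \<Rightarrow> act list \<Rightarrow> nat list" where
  "proj_send c [] = []"
| "proj_send c (Snd d a # s) = (if d = c then a # proj_send c s else proj_send c s)"
| "proj_send c (Rcv d a # s) = proj_send c s"

definition L_send :: "fifo_inst \<Rightarrow> act list set" where
  "L_send M = {\<sigma>. set \<sigma> \<subseteq> actions M \<and> (\<forall>c\<in>set (chans M). proj_send c \<sigma> \<in> L_c M c)}"

type_synonym config = "nat \<times> (nat \<Rightarrow> nat list)"

definition init_config :: "fifo_inst \<Rightarrow> config" where
  "init_config M = (init M, \<lambda>c. [])"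

fun fstep :: "fifo_inst \<Rightarrow> config \<Rightarrow> act \<Rightarrow> config \<Rightarrow> bool" where
  "fstep M (q, w) (Snd c a) (q', w') \<longleftrightarrow>
     (q, Snd c a, q') \<in> set (delta M) \<and> w' = w(c := w c @ [a])"
| "fstep M (q, w) (Rcv c a) (q', w') \<longleftrightarrow>
     (q, Rcv c a, q') \<in> set (delta M) \<and> w c = a # w' c \<and> w' = w(c := w' c)"

definition valid_inst :: "fifo_inst \<Rightarrow> bool" where
  "valid_inst M \<longleftrightarrow>
     init M \<in> set (states M)
   \<and> (\<forall>(c, a) \<in> set (alph M). c \<in> set (chans M))
   \<and> (\<forall>(c, a) \<in> set (alph M). \<forall>(c', a') \<in> set (alph M). a = a' \<longrightarrow> c = c')
   \<and> (\<forall>(q, b, q') \<in> set (delta M). q \<in> set (states M) \<and> b \<in> actions M \<and> q' \<in> set (states M))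
   \<and> (\<forall>c\<in>set (chans M). map_of (auts M) c \<noteq> None
        \<and> L_c M c \<noteq> {}
        \<and> bounded_lang (L_c M c)
        \<and> L_c M c \<subseteq> lists (Sigma_c M c))"

definition IB_terminates :: "fifo_inst \<Rightarrow> bool" where
  "IB_terminates M \<longleftrightarrow>
     \<not> (\<exists>s :: nat \<Rightarrow> config. \<exists>\<beta> :: nat \<Rightarrow> act.
          s 0 = init_config M
        \<and> (\<forall>i. \<beta> i \<in> actions M \<and> fstep M (s i) (\<beta> i) (s (Suc i)))
        \<and> (\<forall>i. map \<beta> [0..<Suc i] \<in> Pref (L_send M)))"

fun enc_act :: "act \<Rightarrow> nat" where
  "enc_act (Snd c a) = prod_encode (0, prod_encode (c, a))"
| "enc_act (Rcv c a) = prod_encode (1, prod_encode (c, a))"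

definition enc_triple :: "nat \<times> nat \<times> nat \<Rightarrow> nat" where
  "enc_triple t = (case t of (p, a, q) \<Rightarrow> prod_encode (p, prod_encode (a, q)))"

definition enc_nfa :: "nfa \<Rightarrow> nat" where
  "enc_nfa A = (case A of (I, F, T) \<Rightarrow>
     prod_encode (list_encode I, prod_encode (list_encode F, list_encode (map enc_triple T))))"

definition enc_inst :: "fifo_inst \<Rightarrow> nat" where
  "enc_inst M = list_encode
     [ list_encode (states M),
       list_encode (chans M),
       list_encode (map prod_encode (alph M)),
       list_encode (map (\<lambda>(q, b, q'). enc_triple (q, enc_act b, q')) (delta M)),
       init M,
       list_encode (map (\<lambda>(c, A). prod_encode (c, enc_nfa A)) (auts M)) ]"

end

theory Submission
  imports Defs "HOL-Library.Sublist" "HOL-Library.Infinite_Set"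
begin

text \<open>The decision procedure searches for a certificate of either answer. By Koenig's lemma a
  machine terminates iff it has finitely many finite input-bounded executions; a finite set containing
  all of them is recognised by being closed under admissible one-step extensions. Non-termination is certified by a
  lasso: a run \<open>\<sigma> \<tau>\<close> where \<open>\<tau>\<close> is non-empty, returns to the same control state and to the same states of
  the automata reading the sent words, and on every channel from which it receives changes the content
  from \<open>w\<close> to \<open>w x\<close>, where \<open>x\<close> commutes with the word \<open>s\<close> sent by \<open>\<tau>\<close>. Commutation makes \<open>\<tau>\<close> repeatable, as
  \<open>w s = r w x\<close> gives \<open>w x\<^sup>k s = r w x\<^sup>k\<^sup>+\<^sup>1\<close>. Conversely, boundedness of the languages makes the infinite
  word sent to a channel ultimately periodic, so in an infinite run two moments that agree in their
  control and automata states and in their positions modulo the period, and whose contents have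
  non-decreasing lengths (Dickson's lemma), enclose a lasso.\<close>

section \<open>Total recursive functions on encoded data\<close>

text \<open>Hence a lasso is checked by plain commutation of words, and the period occurs only in
  the proof that a lasso exists. Equality of contents would be too strong a test: a channel may grow
  forever while it is being read, its content being an ever longer window of a periodic word.

  Certificates of both kinds share one search space because minimisation demands a defined value at
  every smaller argument. Two semi-decision procedures cannot be run one after the other, whereas
  one total check applied to all numbers stops as soon as a certificate of either kind turns up.
  This calls for a calculus that derives recursiveness of a check from its HOL definition, without
  writing \<open>recf\<close> terms by hand.\<close>

definition recn :: "nat \<Rightarrow> (nat list \<Rightarrow> nat) \<Rightarrow> bool" where
  "recn n F \<longleftrightarrow> (\<exists>r. \<forall>xs. length xs = n \<longrightarrow> rec_eval r xs (F xs))"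

named_theorems recn_intros

lemma recn_cong: "recn n F \<Longrightarrow> (\<And>xs. length xs = n \<Longrightarrow> F xs = G xs) \<Longrightarrow> recn n G"
  unfolding recn_def by metis

lemma recn_nth [recn_intros]: "i < n \<Longrightarrow> recn n (\<lambda>xs. xs ! i)"
  unfolding recn_def by (metis ev_Proj)

lemma recn_compose:
  assumes "recn (length Fs) G" and "\<And>F. F \<in> set Fs \<Longrightarrow> recn n F"
  shows "recn n (\<lambda>xs. G (map (\<lambda>F. F xs) Fs))"
proof -
  obtain g where g: "\<And>ys. length ys = length Fs \<Longrightarrow> rec_eval g ys (G ys)"
    using assms(1) unfolding recn_def by blast
  obtain r where r: "\<And>F xs. F \<in> set Fs \<Longrightarrow> length xs = n \<Longrightarrow> rec_eval (r F) xs (F xs)"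
    using assms(2) unfolding recn_def by metis
  have "rec_eval (RComp g (map r Fs)) xs (G (map (\<lambda>F. F xs) Fs))" if "length xs = n" for xs
    by (rule ev_Comp[where ys = "map (\<lambda>F. F xs) Fs"])
      (use r that g in \<open>auto simp: list_all2_conv_all_nth\<close>)
  then show ?thesis
    unfolding recn_def by blast
qed

lemma recn_app1: "recn 1 G \<Longrightarrow> recn n F \<Longrightarrow> recn n (\<lambda>xs. G [F xs])"
  using recn_compose[of "[F]" G n] by simp

lemma recn_zero: "recn n (\<lambda>xs. 0)"
  unfolding recn_def using ev_Z by blast

lemma recn_Suc [recn_intros]: "recn n F \<Longrightarrow> recn n (\<lambda>xs. Suc (F xs))"
proof -
  have "recn 1 (\<lambda>xs. Suc (hd xs))"
    unfolding recn_def using ev_S by (auto simp: length_Suc_conv intro!: exI[of _ RS])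
  then show "recn n F \<Longrightarrow> recn n (\<lambda>xs. Suc (F xs))"
    using recn_app1[of "\<lambda>xs. Suc (hd xs)" n F] by simp
qed

lemma recn_const [recn_intros]: "recn n (\<lambda>xs. k)"
  by (induction k) (auto intro: recn_zero recn_Suc)

text \<open>Primitive recursion puts its counter and previous value in front of the arguments; a
  function of the old arguments is reached through projections shifted by \<open>k\<close>.\<close>

lemma recn_drop:
  assumes "recn n F" shows "recn (k + n) (\<lambda>xs. F (drop k xs))"
proof -
  have "recn (k + n) (\<lambda>xs. F (map (\<lambda>G. G xs) (map (\<lambda>i xs. xs ! (k + i)) [0..<n])))"
    by (rule recn_compose) (use assms in \<open>auto intro: recn_nth\<close>)
  then show ?thesis
    by (rule recn_cong) (auto intro!: arg_cong[of _ _ F] nth_equalityI)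
qed

lemma recn_rec_nat:
  assumes "recn n A" and "recn (Suc (Suc n)) B" and "recn n K"
  shows "recn n (\<lambda>xs. rec_nat (A xs) (\<lambda>m y. B (m # y # xs)) (K xs))"
proof -
  obtain a where a: "\<And>xs. length xs = n \<Longrightarrow> rec_eval a xs (A xs)"
    using assms(1) unfolding recn_def by blast
  obtain b where b: "\<And>xs. length xs = Suc (Suc n) \<Longrightarrow> rec_eval b xs (B xs)"
    using assms(2) unfolding recn_def by blast
  have "rec_eval (RPrim a b) (k # xs) (rec_nat (A xs) (\<lambda>m y. B (m # y # xs)) k)"
    if "length xs = n" for k xs
    by (induction k) (use that a b in \<open>auto intro: ev_Prim0 ev_PrimS\<close>)
  then have R: "recn (Suc n) (\<lambda>ys. rec_nat (A (tl ys)) (\<lambda>m y. B (m # y # tl ys)) (hd ys))"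
    unfolding recn_def by (intro exI[of _ "RPrim a b"]) (auto simp: length_Suc_conv)
  \<comment> \<open>\<open>RPrim\<close> recurses on its first argument, so the computed bound is
    put in front of the unchanged arguments.\<close>
  let ?Fs = "K # map (\<lambda>i xs. xs ! i) [0..<n]"
  have "recn n (\<lambda>xs. (\<lambda>ys. rec_nat (A (tl ys)) (\<lambda>m y. B (m # y # tl ys)) (hd ys)) (map (\<lambda>F. F xs) ?Fs))"
    by (rule recn_compose) (use R assms(3) in \<open>auto intro: recn_nth\<close>)
  moreover have "map (\<lambda>F. F xs) ?Fs = K xs # xs" if "length xs = n" for xs
    using that by (auto intro!: nth_equalityI)
  ultimately show ?thesis
    by (elim recn_cong) simp
qed

text \<open>Existence of a zero makes the minimisation total. Below the least zero all values are
  positive, which is what \<open>ev_Mn\<close> asks for.\<close>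

lemma recn_Least:
  assumes "recn (Suc n) B" and ex: "\<And>xs. length xs = n \<Longrightarrow> \<exists>m. B (m # xs) = 0"
  shows "recn n (\<lambda>xs. LEAST m. B (m # xs) = 0)"
proof -
  obtain b where b: "\<And>xs. length xs = Suc n \<Longrightarrow> rec_eval b xs (B xs)"
    using assms(1) unfolding recn_def by blast
  have "rec_eval (RMn b) xs (LEAST m. B (m # xs) = 0)" if xs: "length xs = n" for xs
  proof (rule ev_Mn)
    have "B ((LEAST m. B (m # xs) = 0) # xs) = 0"
      using ex[OF xs] by (rule LeastI_ex)
    then show "rec_eval b ((LEAST m. B (m # xs) = 0) # xs) 0"
      using b[of "(LEAST m. B (m # xs) = 0) # xs"] xs by simp
    show "\<forall>m<(LEAST m. B (m # xs) = 0). \<exists>y. rec_eval b (m # xs) y \<and> 0 < y"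
    proof (intro allI impI)
      fix m assume "m < (LEAST m. B (m # xs) = 0)"
      then have "B (m # xs) \<noteq> 0"
        by (rule not_less_Least)
      moreover have "rec_eval b (m # xs) (B (m # xs))"
        using b[of "m # xs"] xs by simp
      ultimately show "\<exists>y. rec_eval b (m # xs) y \<and> 0 < y"
        by auto
    qed
  qed
  then show ?thesis
    unfolding recn_def by blast
qed

section \<open>Recursive arithmetic and the inverse of the pairing function\<close>

lemma recn_add [recn_intros]: "recn n F \<Longrightarrow> recn n G \<Longrightarrow> recn n (\<lambda>xs. F xs + G xs)"
proof -
  assume "recn n F" "recn n G"
  then have "recn n (\<lambda>xs. rec_nat (F xs) (\<lambda>m y. Suc ((m # y # xs) ! 1)) (G xs))"
    by (intro recn_rec_nat recn_Suc recn_nth) auto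
  moreover have "rec_nat a (\<lambda>m y. Suc y) b = a + b" for a b
    by (induction b) auto
  ultimately show ?thesis by simp
qed

lemma recn_pred: "recn n F \<Longrightarrow> recn n (\<lambda>xs. F xs - 1)"
proof -
  assume "recn n F"
  then have "recn n (\<lambda>xs. rec_nat 0 (\<lambda>m y. (m # y # xs) ! 0) (F xs))"
    by (intro recn_rec_nat recn_zero recn_nth) auto
  moreover have "rec_nat 0 (\<lambda>m y. m) b = b - 1" for b
    by (cases b) auto
  ultimately show ?thesis by simp
qed

lemma recn_diff [recn_intros]: "recn n F \<Longrightarrow> recn n G \<Longrightarrow> recn n (\<lambda>xs. F xs - G xs)"
proof -
  assume "recn n F" "recn n G"
  then have "recn n (\<lambda>xs. rec_nat (F xs) (\<lambda>m y. (m # y # xs) ! 1 - 1) (G xs))"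
    by (intro recn_rec_nat recn_pred recn_nth) auto
  moreover have "rec_nat a (\<lambda>m y. y - 1) b = a - b" for a b :: nat
    by (induction b) auto
  ultimately show ?thesis by simp
qed

lemma recn_if_zero [recn_intros]:
  assumes "recn n C" "recn n F" "recn n G"
  shows "recn n (\<lambda>xs. if C xs = 0 then F xs else G xs)"
proof -
  \<comment> \<open>Case distinction as a recursion whose step ignores counter and previous value:
    every positive bound yields the value of \<open>G\<close>.\<close>
  have "recn n (\<lambda>xs. rec_nat (F xs) (\<lambda>m y. G (drop 2 (m # y # xs))) (C xs))"
    using recn_drop[OF assms(3), of 2] assms by (intro recn_rec_nat) auto
  then show ?thesis
    by (rule recn_cong) (auto simp: gr0_conv_Suc)
qed

lemma recn_triangle: "recn n F \<Longrightarrow> recn n (\<lambda>xs. triangle (F xs))"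
proof -
  assume "recn n F"
  then have "recn n (\<lambda>xs. rec_nat 0 (\<lambda>m y. (m # y # xs) ! 1 + Suc ((m # y # xs) ! 0)) (F xs))"
    by (intro recn_rec_nat recn_intros) auto
  moreover have "rec_nat 0 (\<lambda>m y. y + Suc m) b = triangle b" for b
    by (induction b) auto
  ultimately show ?thesis by simp
qed

lemma recn_prod_encode [recn_intros]:
  "recn n F \<Longrightarrow> recn n G \<Longrightarrow> recn n (\<lambda>xs. prod_encode (F xs, G xs))"
  unfolding prod_encode_def by (simp add: recn_triangle recn_add)

lemma triangle_mono: "m \<le> n \<Longrightarrow> triangle m \<le> triangle n"
  unfolding triangle_def by (intro div_le_mono mult_le_mono) auto

lemma triangle_ge: "n \<le> triangle n"
  by (induction n) auto

text \<open>As \<open>prod_encode (a, b)\<close> is \<open>triangle (a + b) + a\<close>, it lies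
  between \<open>triangle (a + b)\<close> and the next triangular number. The truncated difference
  vanishes iff \<open>z < triangle (Suc s)\<close>, so the least such \<open>s\<close> is
  \<open>a + b\<close>.\<close>

definition triangle_root :: "nat \<Rightarrow> nat" where
  "triangle_root z = (LEAST s. Suc z - triangle (Suc s) = 0)"

lemma triangle_root_prod_encode: "triangle_root (prod_encode (a, b)) = a + b"
  unfolding triangle_root_def
proof (rule Least_equality)
  show "Suc (prod_encode (a, b)) - triangle (Suc (a + b)) = 0"
    by (simp add: prod_encode_def)
next
  fix s assume s: "Suc (prod_encode (a, b)) - triangle (Suc s) = 0"
  show "a + b \<le> s"
  proof (rule ccontr)
    assume "\<not> a + b \<le> s"
    then have "triangle (Suc s) \<le> triangle (a + b)"
      by (intro triangle_mono) auto
    with s show False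
      by (simp add: prod_encode_def del: triangle_Suc)
  qed
qed

lemma recn_triangle_root: "recn n F \<Longrightarrow> recn n (\<lambda>xs. triangle_root (F xs))"
proof -
  assume F: "recn n F"
  have "recn 1 (\<lambda>xs. LEAST m. Suc ((m # xs) ! 1) - triangle (Suc ((m # xs) ! 0)) = 0)"
  proof (rule recn_Least)
    fix xs :: "nat list"
    show "\<exists>m. Suc ((m # xs) ! 1) - triangle (Suc ((m # xs) ! 0)) = 0"
      using triangle_ge[of "Suc (xs ! 0)"] by (intro exI[of _ "xs ! 0"]) simp
  qed (intro recn_intros recn_triangle; simp)
  from recn_app1[OF this F] show ?thesis
    unfolding triangle_root_def by simp
qed

definition pfst :: "nat \<Rightarrow> nat" where "pfst z = z - triangle (triangle_root z)"
definition psnd :: "nat \<Rightarrow> nat" where "psnd z = triangle_root z - pfst z"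

lemma pfst_prod_encode [simp]: "pfst (prod_encode (a, b)) = a"
  by (simp add: pfst_def triangle_root_prod_encode) (simp add: prod_encode_def)

lemma psnd_prod_encode [simp]: "psnd (prod_encode (a, b)) = b"
  by (simp add: psnd_def triangle_root_prod_encode)

lemma recn_pfst [recn_intros]: "recn n F \<Longrightarrow> recn n (\<lambda>xs. pfst (F xs))"
  unfolding pfst_def by (intro recn_intros recn_triangle recn_triangle_root)

lemma recn_psnd [recn_intros]: "recn n F \<Longrightarrow> recn n (\<lambda>xs. psnd (F xs))"
  unfolding psnd_def by (intro recn_intros recn_triangle_root)

section \<open>Data types coded as numbers and functions computable on the codes\<close>

class encodable =
  fixes encode :: "'a \<Rightarrow> nat"
  assumes inj_encode: "inj encode"

lemma encode_eq_iff [simp]: "encode x = encode y \<longleftrightarrow> x = y"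
  using inj_encode by (auto dest: injD)

instantiation nat :: encodable
begin
definition "encode_nat (n::nat) = n"
instance by standard (auto simp: encode_nat_def inj_def)
end

instantiation bool :: encodable
begin
definition "encode_bool b = (if b then 1 else 0 :: nat)"
instance by standard (auto simp: encode_bool_def inj_def split: if_splits)
end

instantiation prod :: (encodable, encodable) encodable
begin
definition "encode_prod p = prod_encode (encode (fst p), encode (snd p))"
instance by standard (auto simp: encode_prod_def inj_def prod_eq_iff)
end

instantiation list :: (encodable) encodable
begin
definition "encode_list xs = list_encode (map encode xs)"
instance
proof
  show "inj (encode :: 'a list \<Rightarrow> nat)"
    unfolding encode_list_def inj_def
    by (auto dest!: map_injective intro: inj_encode simp: list_encode_eq)
qed
end

lemma encode_Nil [simp]: "encode [] = 0"
  and encode_Cons [simp]: "encode (x # xs) = Suc (prod_encode (encode x, encode xs))"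
  by (simp_all add: encode_list_def)

lemma encode_Pair [simp]: "encode (x, y) = prod_encode (encode x, encode y)"
  by (simp add: encode_prod_def)

text \<open>Search runs over numbers, so every number has to be the code of some certificate. Not
  all codings are onto (\<open>bool\<close> uses only 0 and 1), hence surjectivity is shown apart
  from the class, for the types from which certificates are built.\<close>

lemma surj_encode_nat: "surj (encode :: nat \<Rightarrow> nat)"
  by (simp add: encode_nat_def surj_def)

lemma surj_encode_prod:
  assumes "surj (encode :: 'a::encodable \<Rightarrow> nat)" "surj (encode :: 'b::encodable \<Rightarrow> nat)"
  shows "surj (encode :: 'a \<times> 'b \<Rightarrow> nat)"
  unfolding surj_def
proof
  fix n
  obtain a b where n: "n = prod_encode (a, b)"
    by (metis prod_decode_inverse surj_pair)
  with assms show "\<exists>p :: 'a \<times> 'b. n = encode p"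
    by (metis encode_Pair surjD)
qed

lemma surj_encode_list:
  assumes "surj (encode :: 'a::encodable \<Rightarrow> nat)"
  shows "surj (encode :: 'a list \<Rightarrow> nat)"
  unfolding surj_def
proof
  fix n
  have "\<exists>ys :: 'a list. map encode ys = xs" for xs
    using assms by (metis ex_map_conv surjD)
  then show "\<exists>ys :: 'a list. n = encode ys"
    unfolding encode_list_def by (metis list_decode_inverse)
qed

text \<open>The realizer is required to be total also on numbers that encode nothing, so that it can be
  used freely inside primitive recursions.\<close>

definition computable :: "('a::encodable \<Rightarrow> 'b::encodable) \<Rightarrow> bool" where
  "computable f \<longleftrightarrow> (\<exists>F. recn 1 F \<and> (\<forall>x. F [encode x] = encode (f x)))"

named_theorems computable_intros

lemma computableI:
  "recn 1 F \<Longrightarrow> (\<And>x. F [encode x] = encode (f x)) \<Longrightarrow> computable f"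
  unfolding computable_def by auto

lemma recn_1_arg: "recn (Suc 0) (\<lambda>xs. xs ! 0)"
  by (rule recn_nth) simp

lemma computable_id [computable_intros]: "computable (\<lambda>x. x)"
  unfolding computable_def using recn_1_arg by (auto intro!: exI[of _ "\<lambda>xs. xs ! 0"])

lemma computable_const [computable_intros]: "computable (\<lambda>x. c)"
  unfolding computable_def using recn_const by blast

lemma computable_encode [computable_intros]: "computable f \<Longrightarrow> computable (\<lambda>x. encode (f x))"
  unfolding computable_def by (simp add: encode_nat_def)

lemma computable_comp:
  assumes "computable g" "computable f" shows "computable (\<lambda>x. g (f x))"
proof -
  obtain F where F: "recn 1 F" "\<And>x. F [encode x] = encode (g x)"
    using assms(1) unfolding computable_def by blast
  obtain G where G: "recn 1 G" "\<And>x. G [encode x] = encode (f x)"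
    using assms(2) unfolding computable_def by blast
  show ?thesis
    by (rule computableI[of "\<lambda>xs. F [G xs]"], rule recn_app1[OF F(1) G(1)])
      (auto simp: F G)
qed

lemma computable_Pair [computable_intros]:
  assumes "computable f" "computable g" shows "computable (\<lambda>x. (f x, g x))"
proof -
  obtain F where F: "recn 1 F" "\<And>x. F [encode x] = encode (f x)"
    using assms(1) unfolding computable_def by blast
  obtain G where G: "recn 1 G" "\<And>x. G [encode x] = encode (g x)"
    using assms(2) unfolding computable_def by blast
  show ?thesis
    by (rule computableI[of "\<lambda>xs. prod_encode (F xs, G xs)"], intro recn_intros F G)
      (auto simp: F G)
qed

lemma computable_comp2:
  assumes "computable (\<lambda>p. g (fst p) (snd p))" "computable f1" "computable f2"
  shows "computable (\<lambda>x. g (f1 x) (f2 x))"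
  using computable_comp[OF assms(1) computable_Pair[OF assms(2,3)]] by simp

lemma computable_comp3:
  assumes "computable (\<lambda>p. g (fst p) (fst (snd p)) (snd (snd p)))"
    and "computable f1" "computable f2" "computable f3"
  shows "computable (\<lambda>x. g (f1 x) (f2 x) (f3 x))"
  using computable_comp[OF assms(1) computable_Pair[OF assms(2) computable_Pair[OF assms(3,4)]]]
  by simp

lemma computable_fst [computable_intros]:
  assumes "computable f" shows "computable (\<lambda>x. fst (f x))"
proof -
  obtain F where F: "recn 1 F" "\<And>x. F [encode x] = encode (f x)"
    using assms unfolding computable_def by blast
  show ?thesis
    by (rule computableI[of "\<lambda>xs. pfst (F xs)"], intro recn_intros F)
      (auto simp: encode_prod_def F)
qed

lemma computable_snd [computable_intros]:
  assumes "computable f" shows "computable (\<lambda>x. snd (f x))"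
proof -
  obtain F where F: "recn 1 F" "\<And>x. F [encode x] = encode (f x)"
    using assms unfolding computable_def by blast
  show ?thesis
    by (rule computableI[of "\<lambda>xs. psnd (F xs)"], intro recn_intros F)
      (auto simp: encode_prod_def F)
qed

lemma computable_if [computable_intros]:
  assumes "computable b" "computable f" "computable g"
  shows "computable (\<lambda>x. if b x then f x else g x)"
proof -
  obtain B where B: "recn 1 B" "\<And>x. B [encode x] = encode (b x)"
    using assms(1) unfolding computable_def by blast
  obtain F where F: "recn 1 F" "\<And>x. F [encode x] = encode (f x)"
    using assms(2) unfolding computable_def by blast
  obtain G where G: "recn 1 G" "\<And>x. G [encode x] = encode (g x)"
    using assms(3) unfolding computable_def by blast
  show ?thesis
    by (rule computableI[of "\<lambda>xs. if B xs = 0 then G xs else F xs"], intro recn_intros B F G)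
      (auto simp: encode_bool_def B F G)
qed

lemma computable_Not [computable_intros]: "computable b \<Longrightarrow> computable (\<lambda>x. \<not> b x)"
proof -
  assume "computable b"
  then have "computable (\<lambda>x. if b x then False else True)"
    by (intro computable_if computable_const)
  moreover have "(\<lambda>x. if b x then False else True) = (\<lambda>x. \<not> b x)"
    by auto
  ultimately show ?thesis by simp
qed

lemma computable_conj [computable_intros]:
  "computable b \<Longrightarrow> computable c \<Longrightarrow> computable (\<lambda>x. b x \<and> c x)"
proof -
  assume "computable b" "computable c"
  then have "computable (\<lambda>x. if b x then c x else False)"
    by (intro computable_if computable_const)
  moreover have "(\<lambda>x. if b x then c x else False) = (\<lambda>x. b x \<and> c x)"
    by auto
  ultimately show ?thesis by simp
qed

lemma computable_disj [computable_intros]: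
  "computable b \<Longrightarrow> computable c \<Longrightarrow> computable (\<lambda>x. b x \<or> c x)"
proof -
  assume "computable b" "computable c"
  then have "computable (\<lambda>x. if b x then True else c x)"
    by (intro computable_if computable_const)
  moreover have "(\<lambda>x. if b x then True else c x) = (\<lambda>x. b x \<or> c x)"
    by auto
  ultimately show ?thesis by simp
qed

lemma computable_imp [computable_intros]:
  "computable b \<Longrightarrow> computable c \<Longrightarrow> computable (\<lambda>x. b x \<longrightarrow> c x)"
  unfolding imp_conv_disj by (intro computable_disj computable_Not)

lemma computable_eq [computable_intros]:
  fixes f g :: "'a::encodable \<Rightarrow> 'b::encodable"
  assumes "computable f" "computable g" shows "computable (\<lambda>x. f x = g x)"
proof -
  obtain F where F: "recn 1 F" "\<And>x. F [encode x] = encode (f x)"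
    using assms(1) unfolding computable_def by blast
  obtain G where G: "recn 1 G" "\<And>x. G [encode x] = encode (g x)"
    using assms(2) unfolding computable_def by blast
  let ?H = "\<lambda>xs. if (F xs - G xs) + (G xs - F xs) = 0 then 1 else 0"
  have "recn 1 ?H"
    by (intro recn_if_zero recn_add recn_diff recn_const F G)
  moreover have "?H [encode x] = encode (f x = g x)" for x
  proof -
    have "(encode (f x) - encode (g x)) + (encode (g x) - encode (f x)) = 0 \<longleftrightarrow> f x = g x"
      using encode_eq_iff[of "f x" "g x"] by linarith
    then show ?thesis
      by (simp add: encode_bool_def F G)
  qed
  ultimately show ?thesis
    by (rule computableI)
qed

lemma computable_Suc [computable_intros]:
  assumes "computable f" shows "computable (\<lambda>x. Suc (f x))"
proof -
  obtain F where F: "recn 1 F" "\<And>x. F [encode x] = encode (f x)"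
    using assms unfolding computable_def by blast
  show ?thesis
    by (rule computableI[of "\<lambda>xs. Suc (F xs)"], intro recn_intros F)
      (auto simp: F encode_nat_def)
qed

lemma computable_rec_nat:
  assumes a: "computable a"
    and g: "computable (\<lambda>p. g (fst p) (fst (snd p)) (snd (snd p)))"
    and k: "computable k"
  shows "computable (\<lambda>x. rec_nat (a x) (g x) (k x))"
proof -
  obtain A where A: "recn 1 A" "\<And>x. A [encode x] = encode (a x)"
    using a unfolding computable_def by blast
  obtain K where K: "recn 1 K" "\<And>x. K [encode x] = encode (k x)"
    using k unfolding computable_def by blast
  obtain G where G: "recn 1 G" "\<And>p. G [encode p] = encode (g (fst p) (fst (snd p)) (snd (snd p)))"
    using g unfolding computable_def by blast
  \<comment> \<open>Recursion supplies counter, previous value and parameter in this order, while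
    the realizer of \<open>g\<close> expects the parameter first.\<close>
  let ?B = "\<lambda>zs. G [prod_encode (zs ! 2, prod_encode (zs ! 0, zs ! 1))]"
  have "recn 1 (\<lambda>xs. rec_nat (A xs) (\<lambda>m y. ?B (m # y # xs)) (K xs))"
    by (intro recn_rec_nat A K recn_app1[OF G(1)] recn_intros) auto
  moreover have "rec_nat (A [encode x]) (\<lambda>m y. ?B [m, y, encode x]) n = encode (rec_nat (a x) (g x) n)" for x n
  proof (induction n)
    case (Suc n)
    have "G [encode (x, n, rec_nat (a x) (g x) n)] = encode (g x n (rec_nat (a x) (g x) n))"
      using G(2) by (metis fst_conv snd_conv)
    then show ?case using Suc by (simp add: encode_nat_def)
  qed (simp add: A)
  ultimately show ?thesis
    by (elim computableI) (simp add: K encode_nat_def)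
qed

section \<open>Computable operations on lists\<close>

lemma computable_Cons [computable_intros]:
  assumes "computable f" "computable g" shows "computable (\<lambda>x. f x # g x)"
proof -
  obtain F where F: "recn 1 F" "\<And>x. F [encode x] = encode (f x)"
    using assms(1) unfolding computable_def by blast
  obtain G where G: "recn 1 G" "\<And>x. G [encode x] = encode (g x)"
    using assms(2) unfolding computable_def by blast
  show ?thesis
    by (rule computableI[of "\<lambda>xs. Suc (prod_encode (F xs, G xs))"], intro recn_intros F G)
      (auto simp: F G)
qed

lemma computable_case_list [computable_intros]:
  assumes a: "computable a"
    and g: "computable (\<lambda>p. g (fst p) (fst (snd p)) (snd (snd p)))"
    and l: "computable l"
  shows "computable (\<lambda>x. case l x of [] \<Rightarrow> a x | h # t \<Rightarrow> g x h t)"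
proof -
  obtain A where A: "recn 1 A" "\<And>x. A [encode x] = encode (a x)"
    using a unfolding computable_def by blast
  obtain L where L: "recn 1 L" "\<And>x. L [encode x] = encode (l x)"
    using l unfolding computable_def by blast
  obtain G where G: "recn 1 G" "\<And>p. G [encode p] = encode (g (fst p) (fst (snd p)) (snd (snd p)))"
    using g unfolding computable_def by blast
  have G': "G [prod_encode (encode x, prod_encode (encode h, encode t))] = encode (g x h t)" for x h t
    using G(2) by (metis encode_Pair fst_conv snd_conv)
  \<comment> \<open>The code of a non-empty list is the successor of a pair, so
    \<open>L xs - 1\<close> already is the code of head and tail together.\<close>
  have "recn 1 (\<lambda>xs. if L xs = 0 then A xs else G [prod_encode (xs ! 0, L xs - 1)])"
    by (intro recn_intros A L recn_app1[OF G(1)]) auto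
  then show ?thesis
    by (rule computableI) (auto simp: A L G' split: list.split)
qed

text \<open>The unread part of the list travels in the state, and once it is empty the step does
  nothing. So any bound from the length upwards will do; the code of the list itself is such a
  bound, which makes folding available before \<open>length\<close> is known to be
  computable.\<close>

lemma foldl_eq_rec_nat:
  assumes "length l \<le> n"
  shows "foldl g a l = fst (rec_nat (a, l)
    (\<lambda>_ p. case snd p of [] \<Rightarrow> p | h # t \<Rightarrow> (g (fst p) h, t)) n)"
proof -
  let ?R = "rec_nat (a, l) (\<lambda>_ p. case snd p of [] \<Rightarrow> p | h # t \<Rightarrow> (g (fst p) h, t))"
  have "?R k = (foldl g a (take k l), drop k l)" for k
  proof (induction k)
    case (Suc k)
    show ?case
    proof (cases "k < length l")
      case True
      then show ?thesis
        using Suc by (simp add: Cons_nth_drop_Suc[symmetric] take_Suc_conv_app_nth)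
    qed (use Suc in simp)
  qed simp
  then show ?thesis using assms by simp
qed

lemma length_le_encode: "length xs \<le> encode xs"
proof (induction xs)
  case (Cons x xs)
  then show ?case
    using le_prod_encode_2[of "encode xs" "encode x"] by simp
qed simp

lemma computable_foldl [computable_intros]:
  assumes "computable (\<lambda>p. g (fst p) (fst (snd p)) (snd (snd p)))" "computable a" "computable l"
  shows "computable (\<lambda>x. foldl (g x) (a x) (l x))"
proof -
  have "computable (\<lambda>x. fst (rec_nat (a x, l x)
    (\<lambda>_ p. case snd p of [] \<Rightarrow> p | h # t \<Rightarrow> (g x (fst p) h, t)) (encode (l x))))"
    by (intro computable_rec_nat computable_case_list computable_Pair computable_comp3[OF assms(1)]
        computable_fst computable_snd computable_encode computable_id assms(2,3)
        computable_comp[OF assms(3)])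
  then show ?thesis
    by (simp add: foldl_eq_rec_nat[OF length_le_encode])
qed

lemma computable_tl [computable_intros]: "computable l \<Longrightarrow> computable (\<lambda>x. tl (l x))"
proof -
  assume "computable l"
  then have "computable (\<lambda>x. case l x of [] \<Rightarrow> [] | h # t \<Rightarrow> t)"
    by (intro computable_intros)
  moreover have "(case l x of [] \<Rightarrow> [] | h # t \<Rightarrow> t) = tl (l x)" for x
    by (cases "l x") auto
  ultimately show ?thesis by simp
qed

lemma computable_rev [computable_intros]: "computable l \<Longrightarrow> computable (\<lambda>x. rev (l x))"
proof -
  assume "computable l"
  then have "computable (\<lambda>x. foldl (\<lambda>a y. y # a) [] (l x))"
    by (intro computable_intros)
  moreover have "foldl (\<lambda>a y. y # a) b xs = rev xs @ b" for b xs :: "'b list"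
    by (induction xs arbitrary: b) auto
  ultimately show ?thesis by simp
qed

lemma computable_append [computable_intros]:
  "computable f \<Longrightarrow> computable g \<Longrightarrow> computable (\<lambda>x. f x @ g x)"
proof -
  assume "computable f" "computable g"
  then have "computable (\<lambda>x. foldl (\<lambda>a y. y # a) (g x) (rev (f x)))"
    by (intro computable_intros)
  moreover have "foldl (\<lambda>a y. y # a) b xs = rev xs @ b" for b xs :: "'b list"
    by (induction xs arbitrary: b) auto
  ultimately show ?thesis by simp
qed

lemma computable_map [computable_intros]:
  assumes "computable (\<lambda>p. h (fst p) (snd p))" "computable l"
  shows "computable (\<lambda>x. map (h x) (l x))"
proof -
  have "computable (\<lambda>x. rev (foldl (\<lambda>a y. h x y # a) [] (l x)))"
    by (intro computable_intros computable_comp2[OF assms(1)] assms(2))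
  moreover have "foldl (\<lambda>a y. h x y # a) b xs = rev (map (h x) xs) @ b" for x b xs
    by (induction xs arbitrary: b) auto
  ultimately show ?thesis by simp
qed

lemma computable_filter [computable_intros]:
  assumes "computable (\<lambda>p. h (fst p) (snd p))" "computable l"
  shows "computable (\<lambda>x. filter (h x) (l x))"
proof -
  have "computable (\<lambda>x. rev (foldl (\<lambda>a y. if h x y then y # a else a) [] (l x)))"
    by (intro computable_intros computable_comp2[OF assms(1)] assms(2))
  moreover have "foldl (\<lambda>a y. if h x y then y # a else a) b xs = rev (filter (h x) xs) @ b" for x b xs
    by (induction xs arbitrary: b) auto
  ultimately show ?thesis by simp
qed

lemma computable_Ball [computable_intros]:
  assumes "computable (\<lambda>p. h (fst p) (snd p))" "computable l"
  shows "computable (\<lambda>x. \<forall>y\<in>set (l x). h x y)"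
proof -
  have "computable (\<lambda>x. foldl (\<lambda>a y. a \<and> h x y) True (l x))"
    by (intro computable_intros computable_comp2[OF assms(1)] assms(2))
  moreover have "foldl (\<lambda>a y. a \<and> h x y) b xs \<longleftrightarrow> b \<and> (\<forall>y\<in>set xs. h x y)" for x b xs
    by (induction xs arbitrary: b) auto
  ultimately show ?thesis by simp
qed

lemma computable_Bex [computable_intros]:
  assumes "computable (\<lambda>p. h (fst p) (snd p))" "computable l"
  shows "computable (\<lambda>x. \<exists>y\<in>set (l x). h x y)"
proof -
  have "computable (\<lambda>x. \<not> (\<forall>y\<in>set (l x). \<not> h x y))"
    by (intro computable_intros computable_comp2[OF assms(1)] assms(2))
  then show ?thesis by simp
qed

lemma computable_member [computable_intros]:
  assumes "computable f" "computable l" shows "computable (\<lambda>x. f x \<in> set (l x))"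
proof -
  have "computable (\<lambda>x. \<exists>y\<in>set (l x). y = f x)"
    by (intro computable_intros computable_comp[OF assms(1)] assms(2))
  then show ?thesis by simp
qed

lemma computable_set_eq [computable_intros]:
  assumes "computable f" "computable g" shows "computable (\<lambda>x. set (f x) = set (g x))"
proof -
  have "computable (\<lambda>x. (\<forall>y\<in>set (f x). y \<in> set (g x)) \<and> (\<forall>y\<in>set (g x). y \<in> set (f x)))"
    by (intro computable_intros computable_comp[OF assms(1)] computable_comp[OF assms(2)] assms)
  moreover have "(\<forall>y\<in>set (f x). y \<in> set (g x)) \<and> (\<forall>y\<in>set (g x). y \<in> set (f x))
    \<longleftrightarrow> set (f x) = set (g x)" for x
    by blast
  ultimately show ?thesis by simp
qed

lemma computable_length [computable_intros]: "computable l \<Longrightarrow> computable (\<lambda>x. length (l x))"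
proof -
  assume "computable l"
  then have "computable (\<lambda>x. foldl (\<lambda>a y. Suc a) 0 (l x))"
    by (intro computable_intros)
  moreover have "foldl (\<lambda>a y. Suc a) b xs = length xs + b" for b and xs :: "'b list"
    by (induction xs arbitrary: b) auto
  ultimately show ?thesis by simp
qed

lemma computable_drop [computable_intros]:
  assumes "computable k" "computable l" shows "computable (\<lambda>x. drop (k x) (l x))"
proof -
  have "computable (\<lambda>x. rec_nat (l x) (\<lambda>m y. tl y) (k x))"
    by (intro computable_intros computable_rec_nat assms)
  moreover have "rec_nat xs (\<lambda>m y. tl y) n = drop n xs" for n and xs :: "'b list"
    by (induction n) (auto simp: drop_Suc drop_tl)
  ultimately show ?thesis by simp
qed

lemma computable_prefix [computable_intros]:
  assumes "computable f" "computable g" shows "computable (\<lambda>x. prefix (f x) (g x))"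
proof -
  have "computable (\<lambda>x. fst (foldl (\<lambda>p a. case snd p of [] \<Rightarrow> (False, []) | h # t \<Rightarrow> (fst p \<and> h = a, t))
      (True, g x) (f x)))"
    by (intro computable_intros assms)
  moreover have "fst (foldl (\<lambda>p a. case snd p of [] \<Rightarrow> (False, []) | h # t \<Rightarrow> (fst p \<and> h = a, t))
      (b, v) u) \<longleftrightarrow> b \<and> prefix u v" for b and u v :: "'b list"
    by (induction u arbitrary: b v) (auto split: list.split)
  ultimately show ?thesis by simp
qed

text \<open>\<open>Q\<close> recognises certificates and \<open>A\<close> reads the answer off the
  first one found; any accepted certificate gives the right answer, so it does not matter which one
  this is. \<open>H\<close> translates the prescribed code of an instance into the code on which
  \<open>Q\<close> and \<open>A\<close> work.\<close>

lemma decidable_on_by_search: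
  fixes Q A :: "'a::encodable \<times> 'b::encodable \<Rightarrow> bool"
  assumes "computable Q" "computable A"
    and surj: "surj (encode :: 'b \<Rightarrow> nat)"
    and H: "recn 1 H" "\<And>x. H [enc x] = encode (h x)"
    and ex: "\<And>x. D x \<Longrightarrow> \<exists>y. Q (h x, y)"
    and correct: "\<And>x y. D x \<Longrightarrow> Q (h x, y) \<Longrightarrow> A (h x, y) \<longleftrightarrow> P x"
  shows "decidable_on enc D P"
proof -
  obtain FQ where FQ: "recn 1 FQ" "\<And>p. FQ [encode p] = encode (Q p)"
    using assms(1) unfolding computable_def by blast
  obtain FA where FA: "recn 1 FA" "\<And>p. FA [encode p] = encode (A p)"
    using assms(2) unfolding computable_def by blast
  \<comment> \<open>Minimisation prepends the candidate, so index 0 holds the certificate and index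
    1 the instance.\<close>
  have pair: "recn 2 (\<lambda>xs. prod_encode (H [xs ! 1], xs ! 0))"
    by (intro recn_intros recn_app1[OF H(1)]) auto
  \<comment> \<open>Acceptance has value 1 but minimisation looks for a zero, hence the
    complement.\<close>
  obtain q where q: "\<And>xs. length xs = 2 \<Longrightarrow>
      rec_eval q xs (1 - FQ [prod_encode (H [xs ! 1], xs ! 0)])"
    using recn_diff[OF recn_const[of 2 1] recn_app1[OF FQ(1) pair]] unfolding recn_def by blast
  obtain a where a: "\<And>xs. length xs = 2 \<Longrightarrow>
      rec_eval a xs (FA [prod_encode (H [xs ! 1], xs ! 0)])"
    using recn_app1[OF FA(1) pair] unfolding recn_def by blast
  have "rec_eval (RComp a [RMn q, RProj 0]) [enc x] (if P x then 1 else 0)" if x: "D x" for x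
  proof -
    define n where "n = (LEAST n. FQ [prod_encode (encode (h x), n)] = 1)"
    obtain y0 where "Q (h x, y0)"
      using ex[OF x] by blast
    then have "FQ [prod_encode (encode (h x), encode y0)] = 1"
      using FQ(2)[of "(h x, y0)"] by (simp add: encode_bool_def)
    then have n: "FQ [prod_encode (encode (h x), n)] = 1"
      unfolding n_def by (rule LeastI)
    have q': "rec_eval q [m, enc x] (1 - FQ [prod_encode (encode (h x), m)])" for m
      using q[of "[m, enc x]"] by (simp add: H)
    have mn: "rec_eval (RMn q) [enc x] n"
    proof (rule ev_Mn)
      show "rec_eval q [n, enc x] 0"
        using q'[of n] n by simp
      show "\<forall>m<n. \<exists>y. rec_eval q [m, enc x] y \<and> 0 < y"
      proof (intro allI impI)
        fix m assume "m < n"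
        then have "FQ [prod_encode (encode (h x), m)] \<noteq> 1"
          unfolding n_def by (rule not_less_Least)
        \<comment> \<open>Surjectivity of the coding: the value at \<open>m\<close> is that of a
          genuine candidate, hence 0 or 1, and only 0 is left.\<close>
        moreover obtain y :: 'b where "m = encode y"
          using surj by (metis surjD)
        ultimately have "FQ [prod_encode (encode (h x), m)] = 0"
          using FQ(2)[of "(h x, y)"] by (auto simp: encode_bool_def split: if_splits)
        then show "\<exists>y. rec_eval q [m, enc x] y \<and> 0 < y"
          using q'[of m] by auto
      qed
    qed
    obtain y :: 'b where y: "n = encode y"
      using surj by (metis surjD)
    then have "Q (h x, y)"
      using n FQ(2)[of "(h x, y)"] by (auto simp: encode_bool_def split: if_splits)
    then have "FA [prod_encode (H [enc x], n)] = (if P x then 1 else 0)"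
      using FA(2)[of "(h x, y)"] y correct[OF x] by (simp add: H encode_bool_def)
    then have "rec_eval a [n, enc x] (if P x then 1 else 0)"
      using a[of "[n, enc x]"] by simp
    moreover have "rec_eval (RProj 0) [enc x] (enc x)"
      using ev_Proj[of 0 "[enc x]"] by simp
    ultimately show ?thesis
      using mn by (intro ev_Comp[where ys = "[n, enc x]"]) auto
  qed
  then show ?thesis
    unfolding decidable_on_def by blast
qed

section \<open>Words over finite and bounded languages\<close>

lemma koenig_words:
  assumes "infinite E" and prefix_closed: "\<And>u v. u @ v \<in> E \<Longrightarrow> u \<in> E"
    and "finite D" and letters: "\<And>u. u \<in> E \<Longrightarrow> set u \<subseteq> D"
  obtains f :: "nat \<Rightarrow> 'a" where "\<And>n. map f [0..<n] \<in> E"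
proof -
  define I where "I w \<longleftrightarrow> infinite {u \<in> E. prefix w u}" for w
  have step: "\<exists>t. I (w @ [t])" if "I w" for w
  proof (rule ccontr)
    assume "\<nexists>t. I (w @ [t])"
    \<comment> \<open>Apart from \<open>w\<close> itself, the words of \<open>E\<close> that extend
      \<open>w\<close> are sorted by their next letter, which lies in the finite set
      \<open>D\<close>.\<close>
    then have "finite (insert w (\<Union>t\<in>D. {u \<in> E. prefix (w @ [t]) u}))"
      using \<open>finite D\<close> unfolding I_def by auto
    moreover have "{u \<in> E. prefix w u} \<subseteq> insert w (\<Union>t\<in>D. {u \<in> E. prefix (w @ [t]) u})"
    proof
      fix u assume "u \<in> {u \<in> E. prefix w u}"
      then obtain v where u: "u \<in> E" "u = w @ v"
        by (auto elim: prefixE)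
      show "u \<in> insert w (\<Union>t\<in>D. {u \<in> E. prefix (w @ [t]) u})"
      proof (cases v)
        case (Cons t v')
        with u letters[of u] show ?thesis by auto
      qed (use u in auto)
    qed
    ultimately show False
      using that finite_subset unfolding I_def by blast
  qed
  have "\<exists>W. \<forall>n. (I (W n) \<and> length (W n) = n) \<and> (\<exists>t. W (Suc n) = W n @ [t])"
  proof (rule dependent_nat_choice)
    show "\<exists>w. I w \<and> length w = 0"
      using assms(1) unfolding I_def by auto
  qed (use step in fastforce)
  then obtain W where W: "\<And>n. I (W n)" "\<And>n. length (W n) = n" "\<And>n. \<exists>t. W (Suc n) = W n @ [t]"
    by blast
  define f where "f n = last (W (Suc n))" for n
  have "map f [0..<n] = W n" for n
  proof (induction n)
    case (Suc n)
    obtain t where "W (Suc n) = W n @ [t]"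
      using W(3) by blast
    then show ?case
      using Suc by (simp add: f_def)
  qed (use W(2)[of 0] in simp)
  moreover have "W n \<in> E" for n
  proof -
    have "{u \<in> E. prefix (W n) u} \<noteq> {}"
      using W(1)[of n] unfolding I_def by (metis finite.emptyI)
    then show ?thesis
      using prefix_closed by (auto elim: prefixE)
  qed
  ultimately show ?thesis
    using that by metis
qed

lemma Pref_append: "u @ v \<in> Pref L \<Longrightarrow> u \<in> Pref L"
  unfolding Pref_def by auto

section \<open>Infinite words whose prefixes belong to a bounded language\<close>

lemma bounded_by_Nil: "bounded_by [] = {[]}"
  unfolding bounded_by_def by auto

lemma bounded_by_Cons:
  "bounded_by (w # ws) = {concat (replicate k w) @ v | k v. v \<in> bounded_by ws}"
  (is "?L = ?R")
proof (intro equalityI subsetI)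
  fix x assume "x \<in> ?L"
  then obtain ks where ks: "length ks = Suc (length ws)"
    "x = concat (map2 (\<lambda>w k. concat (replicate k w)) (w # ws) ks)"
    unfolding bounded_by_def by auto
  then obtain k ks' where "ks = k # ks'" "length ks' = length ws"
    by (cases ks) auto
  with ks show "x \<in> ?R"
    unfolding bounded_by_def by auto
next
  fix x assume "x \<in> ?R"
  then obtain k ks where "length ks = length ws"
    "x = concat (replicate k w) @ concat (map2 (\<lambda>w k. concat (replicate k w)) ws ks)"
    unfolding bounded_by_def by auto
  then show "x \<in> ?L"
    unfolding bounded_by_def by (intro CollectI exI[of _ "k # ks"]) auto
qed

lemma nth_concat_replicate_period:
  "i < k * length w \<Longrightarrow> concat (replicate k w) ! i = w ! (i mod length w)"
proof (induction k arbitrary: i)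
  case (Suc k)
  then show ?case
    by (cases "i < length w") (auto simp: nth_append le_mod_geq)
qed simp

lemma length_concat_replicate: "length (concat (replicate k w)) = k * length w"
  by (induction k) auto

text \<open>Induction on the bounding words. Either the first exponent can be taken arbitrarily
  large on arbitrarily long prefixes, and then the whole word is the infinite power of
  \<open>w\<close>; or one exponent \<open>k\<close> serves infinitely many prefixes, and removing
  \<open>k\<close> copies of \<open>w\<close> leaves an infinite word governed by the remaining
  bounding words.\<close>

lemma eventually_periodic_of_bounded:
  assumes "\<And>w. w \<in> set ws \<Longrightarrow> w \<noteq> []"
    and "\<And>n. map \<alpha> [0..<n] \<in> Pref (bounded_by ws)"
  shows "\<exists>N p. 0 < p \<and> (\<forall>i\<ge>N. \<alpha> (i + p) = \<alpha> i)"
  using assms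
proof (induction ws arbitrary: \<alpha>)
  case Nil
  from Nil(2)[of 1] show ?case
    by (auto simp: bounded_by_Nil Pref_def)
next
  case (Cons w ws)
  \<comment> \<open>\<open>W n k\<close>: the prefix of length \<open>n\<close> can be completed to
    a bounded word whose first block is the \<open>k\<close>-th power of \<open>w\<close>.\<close>
  define W where "W n k \<longleftrightarrow> (\<exists>v\<in>bounded_by ws. \<exists>z. map \<alpha> [0..<n] @ z = concat (replicate k w) @ v)" for n k
  have ex: "\<exists>k. W n k" for n
    using Cons.prems(2)[of n] unfolding Pref_def bounded_by_Cons W_def by fastforce
  have w: "0 < length w"
    using Cons.prems(1)[of w] by simp
  show ?case
  \<comment> \<open>The lower bound on \<open>n\<close> ensures that a given position lies inside
    the prefix, the one on \<open>k\<close> that it lies inside the first block.\<close>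
  proof (cases "\<forall>K. \<exists>n k. W n k \<and> K \<le> k \<and> K * length w \<le> n")
    case True
    have "\<alpha> i = w ! (i mod length w)" for i
    proof -
      obtain n k where nk: "W n k" "Suc i \<le> k" "Suc i * length w \<le> n"
        using True by blast
      have i: "i < Suc i * length w"
        using w by (cases "length w") auto
      also have "\<dots> \<le> k * length w"
        using nk(2) by (intro mult_le_mono) auto
      finally have i': "i < k * length w" .
      obtain v z where "map \<alpha> [0..<n] @ z = concat (replicate k w) @ v"
        using nk(1) unfolding W_def by blast
      then have "(map \<alpha> [0..<n] @ z) ! i = (concat (replicate k w) @ v) ! i"
        by simp
      then show ?thesis
        using i i' nk(3) by (simp add: nth_append length_concat_replicate nth_concat_replicate_period)
    qed
    then have "\<forall>i\<ge>0. \<alpha> (i + length w) = \<alpha> i"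
      by simp
    with w show ?thesis by blast
  next
    case False
    then obtain K where K: "\<And>n k. W n k \<Longrightarrow> K * length w \<le> n \<Longrightarrow> k < K"
      by (meson leI)
    have "\<exists>k. \<forall>m. \<exists>n\<ge>m. W n k"
    proof (rule ccontr)
      assume "\<nexists>k. \<forall>m. \<exists>n\<ge>m. W n k"
      then obtain m where m: "\<And>k n. m k \<le> n \<Longrightarrow> \<not> W n k"
        by metis
      \<comment> \<open>This length forces the exponent below \<open>K\<close> and also exceeds the
        last length at which any exponent below \<open>K\<close> could be used.\<close>
      define n where "n = K * length w + (\<Sum>k<K. m k)"
      obtain k where "W n k"
        using ex by blast
      moreover from this have "k < K"
        using K unfolding n_def by auto
      then have "m k \<le> n"
        unfolding n_def by (intro trans_le_add2 member_le_sum) auto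
      ultimately show False
        using m by blast
    qed
    then obtain k where k: "\<And>m. \<exists>n\<ge>m. W n k"
      by blast
    define d where "d = k * length w"
    \<comment> \<open>A prefix of length at least \<open>n + d\<close> that uses exponent
      \<open>k\<close> is long enough for the block to be cut off with \<open>n\<close> letters
      remaining.\<close>
    have "map (\<lambda>i. \<alpha> (i + d)) [0..<n] \<in> Pref (bounded_by ws)" for n
    proof -
      obtain n' where n': "n' \<ge> n + d" "W n' k"
        using k by blast
      then obtain v z where v: "v \<in> bounded_by ws" "map \<alpha> [0..<n'] @ z = concat (replicate k w) @ v"
        unfolding W_def by blast
      have "drop d (map \<alpha> [0..<n'] @ z) = v"
        unfolding v(2) by (simp add: d_def length_concat_replicate)
      then have "map \<alpha> [d..<n'] @ z = v"
        using n' by (simp add: drop_map)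
      moreover have "map \<alpha> [d..<n'] = map \<alpha> [d..<n + d] @ map \<alpha> [n + d..<n']"
        using upt_add_eq_append[of d "n + d" "n' - (n + d)"] n' by simp
      moreover have "map \<alpha> [d..<n + d] = map (\<lambda>i. \<alpha> (i + d)) [0..<n]"
        by (rule nth_equalityI) (auto simp: add.commute)
      ultimately show ?thesis
        using v(1) unfolding Pref_def by auto
    qed
    then obtain N p where "0 < p" and p: "\<And>i. N \<le> i \<Longrightarrow> \<alpha> (i + p + d) = \<alpha> (i + d)"
      using Cons.IH[of "\<lambda>i. \<alpha> (i + d)"] Cons.prems(1) by auto
    have "\<alpha> (i + p) = \<alpha> i" if "N + d \<le> i" for i
      using p[of "i - d"] that by (simp add: algebra_simps)
    with \<open>0 < p\<close> show ?thesis by blast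
  qed
qed

text \<open>Homogeneity survives passing to subsets, so the index set can be thinned out for one
  element of \<open>C\<close> after the other.\<close>

lemma infinite_homogeneous_finite:
  assumes "finite C"
    and "\<And>c A. c \<in> C \<Longrightarrow> infinite A \<Longrightarrow> \<exists>B\<subseteq>A. infinite B \<and> (\<forall>i\<in>B. \<forall>j\<in>B. i < j \<longrightarrow> G c i j)"
    and "infinite (A :: nat set)"
  shows "\<exists>B\<subseteq>A. infinite B \<and> (\<forall>c\<in>C. \<forall>i\<in>B. \<forall>j\<in>B. i < j \<longrightarrow> G c i j)"
  using assms(1,2)
proof (induction C)
  case empty
  with assms(3) show ?case by auto
next
  case (insert c C)
  then obtain B where B: "B \<subseteq> A" "infinite B" "\<forall>c\<in>C. \<forall>i\<in>B. \<forall>j\<in>B. i < j \<longrightarrow> G c i j"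
    by (metis insertI2)
  obtain B' where "B' \<subseteq> B" "infinite B'" "\<forall>i\<in>B'. \<forall>j\<in>B'. i < j \<longrightarrow> G c i j"
    using insert.prems[of c B] B(2) by auto
  with B show ?case
    by (intro exI[of _ B']) blast
qed

lemma infinite_constant_subset:
  assumes "infinite A" "finite (g ` A)"
  obtains B where "B \<subseteq> A" "infinite B" "\<And>i j. i \<in> B \<Longrightarrow> j \<in> B \<Longrightarrow> g i = g j"
proof -
  obtain a where a: "a \<in> A" "infinite {i \<in> A. g i = g a}"
    using pigeonhole_infinite[OF assms] by auto
  show ?thesis
    by (rule that[OF _ a(2)]) auto
qed

text \<open>The one-dimensional case of Dickson's lemma. The set \<open>B\<close> of indices that
  are minimal among all later ones is infinite, because beyond any \<open>n\<close> the least value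
  of \<open>h\<close> is attained.\<close>

lemma infinite_mono_subset:
  fixes h :: "nat \<Rightarrow> nat"
  assumes "infinite A"
  obtains B where "B \<subseteq> A" "infinite B" "\<And>i j. i \<in> B \<Longrightarrow> j \<in> B \<Longrightarrow> i < j \<Longrightarrow> h i \<le> h j"
proof -
  define B where "B = {i \<in> A. \<forall>j\<in>A. i < j \<longrightarrow> h i \<le> h j}"
  have "\<exists>i\<in>B. n \<le> i" for n
  proof -
    let ?A = "{i \<in> A. n \<le> i}"
    have "infinite ?A"
    proof
      assume "finite ?A"
      then have "finite (?A \<union> {..<n})" by simp
      moreover have "A \<subseteq> ?A \<union> {..<n}" by auto
      ultimately show False
        using assms finite_subset by blast
    qed
    then obtain a where "a \<in> ?A" by (metis all_not_in_conv finite.emptyI)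
    then obtain i where i: "i \<in> ?A" "\<And>j. j \<in> ?A \<Longrightarrow> h i \<le> h j"
      using ex_has_least_nat[of "\<lambda>i. i \<in> ?A" a h] by auto
    then show ?thesis
      unfolding B_def by (intro bexI[of _ i]) auto
  qed
  then have "infinite B"
    unfolding infinite_nat_iff_unbounded_le by blast
  then show ?thesis
    by (intro that[of B]) (auto simp: B_def)
qed

section \<open>Executions as words of transitions\<close>

text \<open>A transition \<open>(q, (k, c, a), q')\<close> sends if \<open>k = 0\<close> and receives otherwise, which makes every
  natural number the code of a list of transitions.\<close>

type_synonym trans = "nat \<times> (nat \<times> nat \<times> nat) \<times> nat"

definition snds :: "nat \<Rightarrow> trans list \<Rightarrow> nat list" where
  "snds c \<sigma> = map (\<lambda>t. snd (snd (fst (snd t))))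
     (filter (\<lambda>t. fst (fst (snd t)) = 0 \<and> fst (snd (fst (snd t))) = c) \<sigma>)"

definition rcvs :: "nat \<Rightarrow> trans list \<Rightarrow> nat list" where
  "rcvs c \<sigma> = map (\<lambda>t. snd (snd (fst (snd t))))
     (filter (\<lambda>t. fst (fst (snd t)) \<noteq> 0 \<and> fst (snd (fst (snd t))) = c) \<sigma>)"

definition end_state :: "nat \<Rightarrow> trans list \<Rightarrow> nat" where
  "end_state q \<sigma> = foldl (\<lambda>_ t. snd (snd t)) q \<sigma>"

text \<open>Channels are first in, first out: the received word is a prefix of the sent word and the
  content is the rest. Configurations can thus be recovered from the word of transitions
  alone.\<close>

definition content :: "nat \<Rightarrow> trans list \<Rightarrow> nat list" where
  "content c \<sigma> = drop (length (rcvs c \<sigma>)) (snds c \<sigma>)"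

text \<open>A fold that carries the part already read, a shape for which computability is available;
  the condition \<open>ok\<close> needs the whole history.\<close>

definition all_steps :: "('a list \<Rightarrow> 'a \<Rightarrow> bool) \<Rightarrow> 'a list \<Rightarrow> bool" where
  "all_steps ok \<sigma> = fst (foldl (\<lambda>p t. (fst p \<and> ok (snd p) t, snd p @ [t])) (True, []) \<sigma>)"

definition pumpable :: "'a list \<Rightarrow> 'a list \<Rightarrow> 'a list \<Rightarrow> bool" where
  "pumpable w w' s \<longleftrightarrow> (\<exists>x. w' = w @ x \<and> x @ s = s @ x)"

lemma snds_simps [simp]: "snds c [] = []" "snds c (\<sigma> @ \<tau>) = snds c \<sigma> @ snds c \<tau>"
  by (simp_all add: snds_def)

lemma rcvs_simps [simp]: "rcvs c [] = []" "rcvs c (\<sigma> @ \<tau>) = rcvs c \<sigma> @ rcvs c \<tau>"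
  by (simp_all add: rcvs_def)

lemma end_state_simps [simp]:
  "end_state q [] = q" "end_state q (\<sigma> @ \<tau>) = end_state (end_state q \<sigma>) \<tau>"
  by (simp_all add: end_state_def)

lemma all_steps_Nil [simp]: "all_steps ok []"
  by (simp add: all_steps_def)

lemma all_steps_snoc [simp]: "all_steps ok (\<sigma> @ [t]) \<longleftrightarrow> all_steps ok \<sigma> \<and> ok \<sigma> t"
proof -
  have "snd (foldl (\<lambda>p t. (fst p \<and> ok (snd p) t, snd p @ [t])) (b, u) \<sigma>) = u @ \<sigma>" for b u \<sigma>
    by (induction \<sigma> arbitrary: b u) auto
  then show ?thesis
    by (simp add: all_steps_def)
qed

lemma all_steps_append: "all_steps ok (\<sigma> @ \<tau>) \<Longrightarrow> all_steps ok \<sigma>"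
  by (induction \<tau> rule: rev_induct) (auto simp flip: append_assoc)

text \<open>Both \<open>s'\<close> and \<open>y @ s'\<close> are prefixes of
  \<open>s @ y = y @ s\<close>, so the shorter one is a prefix of the other. Inserting
  \<open>y\<close> before \<open>s'\<close> therefore does not disturb what can be read.\<close>

lemma prefix_pumped:
  assumes "prefix r (w @ s')" "prefix s' s" "y @ s = s @ y"
  shows "prefix r (w @ y @ s')"
proof -
  have "prefix (y @ s') (s @ y)"
    using assms(2) unfolding assms(3)[symmetric] by simp
  moreover have "prefix s' (s @ y)"
    using assms(2) by (rule prefix_prefix)
  ultimately have "prefix s' (y @ s')"
    by (metis prefix_length_prefix le_add2 length_append)
  then show ?thesis
    using assms(1) by (meson prefix_order.trans same_prefix_prefix)
qed

text \<open>\<open>K c\<close> will be the prefixes of the language of channel \<open>c\<close>, and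
  \<open>st c\<close> the set of automaton states reached: a right-invariant map of finite range
  that determines membership in \<open>K c\<close>. \<open>Nil_K\<close> covers the empty execution,
  since \<open>ok\<close> tests words only after a step.\<close>

locale fifo_words =
  fixes C :: "nat set" and D :: "trans set" and q0 :: nat
    and K :: "nat \<Rightarrow> nat list set" and st :: "nat \<Rightarrow> nat list \<Rightarrow> 's"
  assumes finite_C: "finite C" and finite_D: "finite D"
    and finite_st: "\<And>c. c \<in> C \<Longrightarrow> finite (range (st c))"
    and st_append: "\<And>c u v w. st c u = st c v \<Longrightarrow> st c (u @ w) = st c (v @ w)"
    and st_accept: "\<And>c u v. c \<in> C \<Longrightarrow> st c u = st c v \<Longrightarrow> u \<in> K c \<longleftrightarrow> v \<in> K c"
    and bounded_K: "\<And>c. c \<in> C \<Longrightarrow> \<exists>ws. (\<forall>w\<in>set ws. w \<noteq> []) \<and> K c \<subseteq> Pref (bounded_by ws)"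
    and Nil_K: "\<And>c. c \<in> C \<Longrightarrow> [] \<in> K c"
begin

definition ok :: "trans list \<Rightarrow> trans \<Rightarrow> bool" where
  "ok \<sigma> t \<longleftrightarrow> t \<in> D \<and> fst t = end_state q0 \<sigma> \<and>
    (\<forall>c\<in>C. prefix (rcvs c (\<sigma> @ [t])) (snds c (\<sigma> @ [t])) \<and> snds c (\<sigma> @ [t]) \<in> K c)"

abbreviation "exec \<equiv> all_steps ok"

definition lasso :: "trans list \<Rightarrow> trans list \<Rightarrow> bool" where
  "lasso \<sigma> \<tau> \<longleftrightarrow> \<tau> \<noteq> [] \<and> exec (\<sigma> @ \<tau>) \<and> end_state q0 (\<sigma> @ \<tau>) = end_state q0 \<sigma> \<and>
    (\<forall>c\<in>C. st c (snds c (\<sigma> @ \<tau>)) = st c (snds c \<sigma>) \<and>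
      (rcvs c \<tau> = [] \<or> pumpable (content c \<sigma>) (content c (\<sigma> @ \<tau>)) (snds c \<tau>)))"

lemma exec_prefix: "exec \<sigma> \<Longrightarrow> c \<in> C \<Longrightarrow> prefix (rcvs c \<sigma>) (snds c \<sigma>)"
  by (cases \<sigma> rule: rev_cases) (auto simp: ok_def)

lemma exec_content: "exec \<sigma> \<Longrightarrow> c \<in> C \<Longrightarrow> snds c \<sigma> = rcvs c \<sigma> @ content c \<sigma>"
  using exec_prefix[of \<sigma> c] by (auto simp: content_def elim: prefixE)

lemma exec_K: "exec \<sigma> \<Longrightarrow> c \<in> C \<Longrightarrow> snds c \<sigma> \<in> K c"
  by (cases \<sigma> rule: rev_cases) (auto simp: ok_def Nil_K)

lemma exec_letters: "exec \<sigma> \<Longrightarrow> set \<sigma> \<subseteq> D"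
  by (induction \<sigma> rule: rev_induct) (auto simp: ok_def)

text \<open>The word \<tau> is replayed after \<rho> instead of \<sigma>. Equal values of
  \<open>st\<close> keep the sent words admissible; receives still succeed by
  \<open>prefix_pumped\<close>, as contents are only prolonged by a commuting \<open>y\<close>.
  Commutation concerns the whole loop while the induction runs over its initial parts, and \<tau>'
  stands for the part of the loop still to come.\<close>

lemma exec_transfer:
  assumes \<rho>: "exec \<rho>" and \<sigma>\<tau>: "exec (\<sigma> @ \<tau> @ \<tau>')"
    and end_eq: "end_state q0 \<rho> = end_state q0 \<sigma>"
    and st_eq: "\<And>c. c \<in> C \<Longrightarrow> st c (snds c \<rho>) = st c (snds c \<sigma>)"
    and cont: "\<And>c. c \<in> C \<Longrightarrow> rcvs c (\<tau> @ \<tau>') = [] \<or>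
      (\<exists>y. content c \<rho> = content c \<sigma> @ y \<and> y @ snds c (\<tau> @ \<tau>') = snds c (\<tau> @ \<tau>') @ y)"
  shows "exec (\<rho> @ \<tau>)"
  using \<sigma>\<tau> cont
proof (induction \<tau> arbitrary: \<tau>' rule: rev_induct)
  case (snoc t \<tau>)
  have IH: "exec (\<rho> @ \<tau>)"
    using snoc.IH[of "t # \<tau>'"] snoc.prems by simp
  have exec: "exec (\<sigma> @ \<tau> @ [t])"
    using snoc.prems(1) all_steps_append[of ok "\<sigma> @ \<tau> @ [t]" \<tau>'] by simp
  then have okt: "ok (\<sigma> @ \<tau>) t"
    by (simp flip: append_assoc)
  have "ok (\<rho> @ \<tau>) t"
    unfolding ok_def
  proof (intro conjI ballI)
    show "t \<in> D" "fst t = end_state q0 (\<rho> @ \<tau>)"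
      using okt end_eq by (auto simp: ok_def)
  next
    fix c assume c: "c \<in> C"
    have "st c (snds c \<rho> @ snds c (\<tau> @ [t])) = st c (snds c \<sigma> @ snds c (\<tau> @ [t]))"
      by (rule st_append) (rule st_eq[OF c])
    moreover have "snds c \<sigma> @ snds c (\<tau> @ [t]) \<in> K c"
      using okt c by (simp add: ok_def)
    ultimately show "snds c ((\<rho> @ \<tau>) @ [t]) \<in> K c"
      using st_accept[OF c, of "snds c \<rho> @ snds c (\<tau> @ [t])"] by fastforce
    let ?r = "rcvs c (\<tau> @ [t])" and ?s' = "snds c (\<tau> @ [t])"
    have "prefix (rcvs c \<sigma> @ ?r) (snds c \<sigma> @ ?s')"
      using okt c by (simp add: ok_def)
    then have r: "prefix ?r (content c \<sigma> @ ?s')"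
      unfolding exec_content[OF all_steps_append[OF snoc.prems(1)] c] by simp
    have prefix: "prefix ?s' (snds c ((\<tau> @ [t]) @ \<tau>'))"
      unfolding snds_simps(2)[of c "\<tau> @ [t]" \<tau>'] by (rule prefixI) (rule refl)
    have "prefix ?r (content c \<rho> @ ?s')"
      using snoc.prems(2)[OF c]
    proof
      assume "\<exists>y. content c \<rho> = content c \<sigma> @ y \<and>
        y @ snds c ((\<tau> @ [t]) @ \<tau>') = snds c ((\<tau> @ [t]) @ \<tau>') @ y"
      then obtain y where y: "content c \<rho> = content c \<sigma> @ y"
        "y @ snds c ((\<tau> @ [t]) @ \<tau>') = snds c ((\<tau> @ [t]) @ \<tau>') @ y"
        by blast
      show ?thesis
        using prefix_pumped[OF r prefix y(2)] y(1) by simp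
    next
      assume "rcvs c ((\<tau> @ [t]) @ \<tau>') = []"
      then have "?r = []"
        by (metis append_is_Nil_conv rcvs_simps(2))
      then show ?thesis by simp
    qed
    then show "prefix (rcvs c ((\<rho> @ \<tau>) @ [t])) (snds c ((\<rho> @ \<tau>) @ [t]))"
      using exec_content[OF \<rho> c] by simp
  qed
  with IH show ?case
    by (simp flip: append_assoc)
qed (use \<rho> in simp)

text \<open>The invariant keeps only some surplus \<open>y\<close> commuting with the sent word
  \<open>s\<close> rather than an explicit power of \<open>x\<close>: commuting with
  \<open>s\<close> is closed under concatenation, so one more round just turns \<open>y\<close> into
  \<open>x @ y\<close>.\<close>

lemma lasso_pump:
  assumes "lasso \<sigma> \<tau>"
  defines "\<rho> k \<equiv> \<sigma> @ concat (replicate k \<tau>)"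
  shows "exec (\<rho> k) \<and> end_state q0 (\<rho> k) = end_state q0 \<sigma> \<and>
    (\<forall>c\<in>C. st c (snds c (\<rho> k)) = st c (snds c \<sigma>) \<and> (rcvs c \<tau> = [] \<or>
      (\<exists>y. content c (\<rho> k) = content c \<sigma> @ y \<and> y @ snds c \<tau> = snds c \<tau> @ y)))"
proof (induction k)
  case 0
  then show ?case
    using assms all_steps_append unfolding lasso_def by auto
next
  case (Suc k)
  have \<rho>: "\<rho> (Suc k) = \<rho> k @ \<tau>"
    unfolding \<rho>_def by (simp flip: replicate_append_same)
  have exec: "exec (\<rho> k @ \<tau>)"
    by (rule exec_transfer[where \<sigma> = \<sigma> and \<tau>' = "[]"]) (use Suc assms(1) in \<open>auto simp: lasso_def\<close>)
  have "st c (snds c (\<rho> k @ \<tau>)) = st c (snds c \<sigma>)" if "c \<in> C" for c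
    using Suc assms(1) that st_append[of c "snds c (\<rho> k)" "snds c \<sigma>" "snds c \<tau>"]
    by (auto simp: lasso_def)
  moreover have "\<exists>y. content c (\<rho> k @ \<tau>) = content c \<sigma> @ y \<and> y @ snds c \<tau> = snds c \<tau> @ y"
    if c: "c \<in> C" and r: "rcvs c \<tau> \<noteq> []" for c
  proof -
    let ?s = "snds c \<tau>" and ?w = "content c \<sigma>" and ?r = "rcvs c \<tau>"
    obtain y where y: "content c (\<rho> k) = ?w @ y" "y @ ?s = ?s @ y"
      using Suc c r by auto
    obtain x where x: "content c (\<sigma> @ \<tau>) = ?w @ x" "x @ ?s = ?s @ x"
      using assms(1) c r unfolding lasso_def pumpable_def by blast
    have \<sigma>: "exec \<sigma>" "exec (\<sigma> @ \<tau>)"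
      using assms(1) all_steps_append unfolding lasso_def by auto
    have ws: "?w @ ?s = ?r @ ?w @ x"
      using exec_content[OF \<sigma>(1) c] exec_content[OF \<sigma>(2) c] x(1) by simp
    \<comment> \<open>The surplus \<open>y\<close> is moved past \<open>s\<close>; what stands
      before it is the first round, already known to be \<open>?r @ ?w @ x\<close>.\<close>
    have "?r @ content c (\<rho> k @ \<tau>) = content c (\<rho> k) @ ?s"
      using exec_content[OF conjunct1[OF Suc] c] exec_content[OF exec c] by simp
    also have "\<dots> = (?w @ ?s) @ y"
      using y by simp
    also have "\<dots> = ?r @ ?w @ x @ y"
      unfolding ws by simp
    finally have "content c (\<rho> k @ \<tau>) = ?w @ (x @ y)"
      by simp
    moreover have "(x @ y) @ ?s = ?s @ (x @ y)"
      using x(2) y(2) by (metis append_assoc)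
    ultimately show ?thesis by blast
  qed
  ultimately show ?case
    using exec Suc assms(1) unfolding \<rho> lasso_def by auto
qed

lemma lasso_infinite: 
  assumes "lasso \<sigma> \<tau>" shows "infinite {\<sigma>. exec \<sigma>}"
proof
  assume "finite {\<sigma>. exec \<sigma>}"
  then have fin: "finite (length ` {\<sigma>. exec \<sigma>})"
    by simp
  have "k \<le> Max (length ` {\<sigma>. exec \<sigma>})" for k
  proof -
    have "k \<le> length (\<sigma> @ concat (replicate k \<tau>))"
      using assms by (cases \<tau>) (auto simp: length_concat_replicate lasso_def)
    also have "\<dots> \<le> Max (length ` {\<sigma>. exec \<sigma>})"
      using lasso_pump[OF assms, of k] fin by (intro Max_ge imageI) auto
    finally show ?thesis .
  qed
  then show False
    using Suc_n_not_le_n by blast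
qed

end

section \<open>Windows of an ultimately periodic word\<close>

lemma map_periodic:
  assumes "\<And>i. N \<le> i \<Longrightarrow> \<alpha> (i + p) = \<alpha> i" "N \<le> a" "b = a + k * p"
  shows "map \<alpha> [b..<b + n] = map \<alpha> [a..<a + n]"
proof -
  have "\<alpha> (i + k * p) = \<alpha> i" if "N \<le> i" for i
  proof (induction k)
    case (Suc k)
    then show ?case
      using assms(1)[of "i + k * p"] that by (simp add: algebra_simps)
  qed simp
  then have "\<alpha> (b + i) = \<alpha> (a + i)" for i
    using assms(2,3) by (metis add.assoc add.commute trans_le_add1)
  then show ?thesis
    by (intro nth_equalityI) auto
qed

lemma eq_mod_imp_add_mult:
  fixes i j p :: nat
  assumes "i \<le> j" "i mod p = j mod p"
  obtains k where "j = i + k * p"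
proof -
  have "p dvd j - i"
    using assms by (metis mod_eq_dvd_iff_nat)
  then obtain k where "j - i = k * p"
    by (metis dvdE mult.commute)
  then show ?thesis
    using assms(1) that[of k] by auto
qed

text \<open>With \<open>R\<close> messages received and \<open>S\<close> sent, the content is the
  window from \<open>R\<close> to \<open>S\<close> of the infinite sent word. Moving the old window
  by a multiple of \<open>p\<close> shows that the new content starts with the old one. The surplus
  and the newly sent word both consist of whole periods starting at positions congruent to
  \<open>S\<close>, so they are powers of the same word and commute.\<close>

lemma pumpable_periodic:
  fixes R S R' S' :: nat
  assumes per: "\<And>i. N \<le> i \<Longrightarrow> \<alpha> (i + p) = \<alpha> i"
    and "N \<le> R" "R \<le> R'" "R \<le> S" "S \<le> S'" "R' \<le> S'" "S - R \<le> S' - R'"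
    and "R mod p = R' mod p" "S mod p = S' mod p"
  shows "pumpable (map \<alpha> [R..<S]) (map \<alpha> [R'..<S']) (map \<alpha> [S..<S'])"
proof -
  obtain k where k: "R' = R + k * p"
    using eq_mod_imp_add_mult assms(3,8) by blast
  obtain l where l: "S' = S + l * p"
    using eq_mod_imp_add_mult assms(5,9) by blast
  \<comment> \<open>The position in the new window at which the copy of the old content
    ends.\<close>
  define a where "a = R' + (S - R)"
  have a: "a = S + k * p"
    using k assms(4) unfolding a_def by simp
  have aS': "a \<le> S'"
    unfolding a_def using assms by linarith
  define m where "m = S' - a"
  have "k \<le> l" if "p \<noteq> 0"
    using aS' that unfolding a l by simp
  \<comment> \<open>For \<open>p = 0\<close> the congruences are equalities and the surplus is
    empty, in agreement with the formula.\<close>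
  then have m: "m = (l - k) * p"
    unfolding m_def a l by (cases "p = 0") (auto simp: diff_mult_distrib)
  have "N \<le> S"
    using assms by linarith
  have shift: "map \<alpha> [S + j * p..<S + j * p + n] = map \<alpha> [S..<S + n]" for j n
    by (rule map_periodic[of N \<alpha> p]) (use per \<open>N \<le> S\<close> in auto)
  have x: "map \<alpha> [a..<S'] = map \<alpha> [S..<S + m]"
    using shift[of k m] aS' unfolding a[symmetric] m_def by simp
  have w: "map \<alpha> [R'..<S'] = map \<alpha> [R..<S] @ map \<alpha> [a..<S']"
  proof -
    have "map \<alpha> [R'..<S'] = map \<alpha> [R'..<a] @ map \<alpha> [a..<S']"
      using upt_add_eq_append[of R' a "S' - a"] aS' unfolding a_def by simp
    moreover have "map \<alpha> [R'..<a] = map \<alpha> [R..<S]"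
      using map_periodic[of N \<alpha> p R R' k "S - R"] per k assms(2,4) unfolding a_def by simp
    ultimately show ?thesis by simp
  qed
  \<comment> \<open>Blocks of \<open>i\<close> and of \<open>j\<close> periods join to a block of
    \<open>i + j\<close>, so commutation reduces to that of addition.\<close>
  have split: "map \<alpha> [S..<S + i * p] @ map \<alpha> [S..<S + j * p] = map \<alpha> [S..<S + (i + j) * p]" for i j
    using upt_add_eq_append[of S "S + i * p" "j * p"] shift[of i "j * p"]
    by (simp add: algebra_simps)
  have "map \<alpha> [a..<S'] @ map \<alpha> [S..<S'] = map \<alpha> [S..<S'] @ map \<alpha> [a..<S']"
    unfolding x unfolding m l split by (simp add: add.commute)
  with w show ?thesis
    unfolding pumpable_def by blast
qed

section \<open>Lassos in infinite executions\<close>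

context fifo_words
begin

lemma infinite_branch:
  assumes "infinite {\<sigma>. exec \<sigma>}"
  obtains f where "\<And>n. exec (map f [0..<n])"
proof -
  have "u \<in> {\<sigma>. exec \<sigma>}" if "u @ v \<in> {\<sigma>. exec \<sigma>}" for u v
    using that all_steps_append by auto
  moreover have "set u \<subseteq> D" if "u \<in> {\<sigma>. exec \<sigma>}" for u
    using that exec_letters by simp
  ultimately obtain f where f: "\<And>n. map f [0..<n] \<in> {\<sigma>. exec \<sigma>}"
    using koenig_words[OF assms _ finite_D] by metis
  then show ?thesis
    by (intro that) simp
qed

lemma infinite_imp_lasso:
  assumes "infinite {\<sigma>. exec \<sigma>}"
  shows "\<exists>\<sigma> \<tau>. lasso \<sigma> \<tau>"
proof -
  obtain f where f: "\<And>n. exec (map f [0..<n])"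
    using infinite_branch[OF assms] by blast
  define P where "P n = map f [0..<n]" for n
  define seg where "seg i j = map f [i..<j]" for i j
  have P_seg: "P i @ seg i j = P j" if "i \<le> j" for i j
    unfolding P_def seg_def using that upt_add_eq_append[of 0 i "j - i"] by simp
  have exec_P: "exec (P n)" for n
    using f by (simp add: P_def)
  \<comment> \<open>The condition that a lasso between the moments \<open>i\<close> and
    \<open>j\<close> puts on channel \<open>c\<close>.\<close>
  define G where "G c i j \<longleftrightarrow> st c (snds c (P j)) = st c (snds c (P i)) \<and>
    (rcvs c (seg i j) = [] \<or> pumpable (content c (P i)) (content c (P j)) (snds c (seg i j)))" for c i j
  have "\<exists>B\<subseteq>A. infinite B \<and> (\<forall>i\<in>B. \<forall>j\<in>B. i < j \<longrightarrow> G c i j)" if c: "c \<in> C" and A: "infinite A" for c A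
  proof -
    define S where "S n = length (snds c (P n))" for n
    define R where "R n = length (rcvs c (P n))" for n
    have R_le_S: "R n \<le> S n" for n
      using prefix_length_le[OF exec_prefix[OF exec_P c]] by (simp add: R_def S_def)
    have S_seg: "S j = S i + length (snds c (seg i j))" and R_seg: "R j = R i + length (rcvs c (seg i j))"
      if "i \<le> j" for i j
      unfolding S_def R_def using P_seg[OF that, symmetric] by simp_all
    have mono: "S i \<le> S j" "R i \<le> R j" if "i \<le> j" for i j
      using S_seg[OF that] R_seg[OF that] by simp_all
    have fin_st: "finite ((\<lambda>n. st c (snds c (P n))) ` X)" for X
      by (rule finite_subset[OF _ finite_st[OF c]]) auto
    show ?thesis
    \<comment> \<open>If unboundedly many messages are received, unboundedly many are sent, and
      periodicity applies to the infinite sent word. Otherwise the number of receives takes finitely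
      many values, and two moments with the same number have no receive between them.\<close>
    proof (cases "\<forall>N. \<exists>n. N \<le> R n")
      case True
      \<comment> \<open>Letter \<open>i\<close> of the infinite sent word, read at the first moment
        when more than \<open>i\<close> messages have been sent; later moments agree because sent
        words only grow.\<close>
      define \<alpha> where "\<alpha> i = snds c (P (LEAST n. i < S n)) ! i" for i
      have \<alpha>: "snds c (P n) = map \<alpha> [0..<S n]" for n
      proof (rule nth_equalityI)
        fix i assume "i < length (snds c (P n))"
        then have i: "i < S n" by (simp add: S_def)
        define m where "m = (LEAST n. i < S n)"
        have m: "m \<le> n" "i < S m"
          unfolding m_def using i by (auto intro: Least_le LeastI)
        have "snds c (P n) = snds c (P m) @ snds c (seg m n)"
          using P_seg[OF m(1), symmetric] by simp
        moreover have "\<alpha> i = snds c (P m) ! i"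
          by (simp add: \<alpha>_def m_def)
        ultimately show "snds c (P n) ! i = map \<alpha> [0..<S n] ! i"
          using i m(2) by (simp add: nth_append S_def)
      qed (simp add: S_def)
      obtain ws where ws: "\<forall>w\<in>set ws. w \<noteq> []" "K c \<subseteq> Pref (bounded_by ws)"
        using bounded_K[OF c] by blast
      have "map \<alpha> [0..<n] \<in> Pref (bounded_by ws)" for n
      proof -
        obtain m where "n \<le> R m"
          using True by blast
        then have "n \<le> S m"
          using R_le_S le_trans by blast
        then have "map \<alpha> [0..<n] @ map \<alpha> [n..<S m] = snds c (P m)"
          using \<alpha>[of m] upt_add_eq_append[of 0 n "S m - n"] by simp
        then show ?thesis
          using exec_K[OF exec_P c, of m] ws(2) Pref_append by (metis subsetD)
      qed
      then obtain N p where p: "0 < p" and per: "\<And>i. N \<le> i \<Longrightarrow> \<alpha> (i + p) = \<alpha> i"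
        using eventually_periodic_of_bounded[of ws \<alpha>] ws(1) by blast
      \<comment> \<open>From this moment on, all that was sent before the periodic part has been
        received, so contents are windows of the periodic part.\<close>
      obtain n0 where n0: "N \<le> R n0"
        using True by blast
      have A': "infinite (A - {..<n0})"
        using A by simp
      have fin: "finite ((\<lambda>n. (st c (snds c (P n)), R n mod p, S n mod p)) ` (A - {..<n0}))"
        by (rule finite_subset[OF _ finite_cartesian_product[OF finite_st[OF c]
              finite_cartesian_product[OF finite_lessThan[of p] finite_lessThan[of p]]]])
          (use p in auto)
      obtain B1 where B1: "B1 \<subseteq> A - {..<n0}" "infinite B1"
        "\<And>i j. i \<in> B1 \<Longrightarrow> j \<in> B1 \<Longrightarrow> (st c (snds c (P i)), R i mod p, S i mod p)
          = (st c (snds c (P j)), R j mod p, S j mod p)"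
        using infinite_constant_subset[OF A' fin] by metis
      obtain B where B: "B \<subseteq> B1" "infinite B"
        "\<And>i j. i \<in> B \<Longrightarrow> j \<in> B \<Longrightarrow> i < j \<Longrightarrow> S i - R i \<le> S j - R j"
        using infinite_mono_subset[OF B1(2), of "\<lambda>n. S n - R n"] by metis
      have "G c i j" if ij: "i \<in> B" "j \<in> B" "i < j" for i j
      proof -
        have B1ij: "st c (snds c (P i)) = st c (snds c (P j))" "R i mod p = R j mod p" "S i mod p = S j mod p"
          using B1(3)[of i j] B(1) ij by auto
        have "n0 \<le> i"
          using B(1) B1(1) ij(1) by force
        then have "N \<le> R i"
          using n0 mono(2) le_trans by blast
        then have "pumpable (map \<alpha> [R i..<S i]) (map \<alpha> [R j..<S j]) (map \<alpha> [S i..<S j])"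
          using per B1ij(2,3) mono[of i j] ij(3) R_le_S B(3)[OF ij]
          by (intro pumpable_periodic[of N \<alpha> p]) auto
        moreover have "content c (P n) = map \<alpha> [R n..<S n]" for n
          by (simp add: content_def \<alpha> drop_map flip: R_def)
        moreover have "snds c (seg i j) = map \<alpha> [S i..<S j]"
        proof -
          have "snds c (P i) @ snds c (seg i j) = map \<alpha> [0..<S j]"
            using P_seg[of i j] ij(3) \<alpha>[of j] by (metis less_imp_le snds_simps(2))
          also have "\<dots> = snds c (P i) @ map \<alpha> [S i..<S j]"
            using \<alpha>[of i] upt_add_eq_append[of 0 "S i" "S j - S i"] mono(1)[of i j] ij(3) by simp
          finally show ?thesis by simp
        qed
        ultimately show ?thesis
          unfolding G_def using B1ij(1) by simp
      qed
      then show ?thesis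
        using B B1(1) by (intro exI[of _ B]) blast
    next
      case False
      then obtain N where N: "\<And>n. R n < N"
        by (meson not_le)
      have fin: "finite ((\<lambda>n. (st c (snds c (P n)), R n)) ` A)"
        by (rule finite_subset[OF _ finite_cartesian_product[OF finite_st[OF c] finite_lessThan[of N]]])
          (use N in auto)
      obtain B where B: "B \<subseteq> A" "infinite B"
        "\<And>i j. i \<in> B \<Longrightarrow> j \<in> B \<Longrightarrow> (st c (snds c (P i)), R i) = (st c (snds c (P j)), R j)"
        using infinite_constant_subset[OF A fin] by metis
      have "G c i j" if ij: "i \<in> B" "j \<in> B" "i < j" for i j
        using B(3)[OF ij(1,2)] R_seg[of i j] ij(3) unfolding G_def by simp
      with B show ?thesis
        by (intro exI[of _ B]) blast
    qed
  qed
  then obtain B where B: "infinite B" "\<forall>c\<in>C. \<forall>i\<in>B. \<forall>j\<in>B. i < j \<longrightarrow> G c i j"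
    using infinite_homogeneous_finite[OF finite_C _ infinite_UNIV_nat, of G] by metis
  \<comment> \<open>In an infinite run every control state reached is the source of the next
    transition, so finiteness of \<open>D\<close> bounds their number.\<close>
  have "range (\<lambda>n. end_state q0 (P n)) \<subseteq> fst ` D"
  proof (intro image_subsetI)
    fix n
    have "ok (P n) (f n)"
      using exec_P[of "Suc n"] by (simp add: P_def)
    then show "end_state q0 (P n) \<in> fst ` D"
      unfolding ok_def by (metis imageI)
  qed
  then have "finite ((\<lambda>n. end_state q0 (P n)) ` B)"
    using finite_D by (meson finite_imageI finite_subset image_mono subset_UNIV)
  then obtain B' where B': "B' \<subseteq> B" "infinite B'"
    "\<And>i j. i \<in> B' \<Longrightarrow> j \<in> B' \<Longrightarrow> end_state q0 (P i) = end_state q0 (P j)"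
    using infinite_constant_subset[OF B(1)] by metis
  obtain i where i: "i \<in> B'"
    using B'(2) by (metis all_not_in_conv finite.emptyI)
  obtain j where j: "j \<in> B'" "i < j"
    using B'(2) unfolding infinite_nat_iff_unbounded by blast
  have "lasso (P i) (seg i j)"
    unfolding lasso_def P_seg[OF less_imp_le[OF j(2)]]
  proof (intro conjI ballI)
    show "seg i j \<noteq> []"
      using j(2) by (simp add: seg_def)
    show "exec (P j)"
      by (rule exec_P)
    show "end_state q0 (P j) = end_state q0 (P i)"
      using B'(3) i j(1) by blast
  next
    fix c assume "c \<in> C"
    then have "G c i j"
      using B(2) B'(1) i j by blast
    then show "st c (snds c (P j)) = st c (snds c (P i))"
      "rcvs c (seg i j) = [] \<or> pumpable (content c (P i)) (content c (P j)) (snds c (seg i j))"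
      unfolding G_def by blast+
  qed
  then show ?thesis by blast
qed

end

section \<open>Regular languages and FIFO machines\<close>

lemma nfa_reach_append:
  "nfa_reach T p (u @ v) q \<longleftrightarrow> (\<exists>r. nfa_reach T p u r \<and> nfa_reach T r v q)"
  by (induction u arbitrary: p) auto

definition nfa_step :: "nfa \<Rightarrow> nat list \<Rightarrow> nat \<Rightarrow> nat list" where
  "nfa_step A S a = map (\<lambda>e. snd (snd e)) (filter (\<lambda>e. fst (snd e) = a \<and> fst e \<in> set S) (snd (snd A)))"

definition nfa_run :: "nfa \<Rightarrow> nat list \<Rightarrow> nat list" where
  "nfa_run A u = foldl (nfa_step A) (fst A) u"

definition nfa_pre :: "nfa \<Rightarrow> nat list \<Rightarrow> nat list" where
  "nfa_pre A R = R @ map fst (filter (\<lambda>e. snd (snd e) \<in> set R) (snd (snd A)))"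

text \<open>The transition list serves as a counter: each round before stabilisation adds the source
  of some transition, so as many rounds as there are transitions suffice.\<close>

definition nfa_coreach :: "nfa \<Rightarrow> nat list" where
  "nfa_coreach A = foldl (\<lambda>R _. nfa_pre A R) (fst (snd A)) (snd (snd A))"

definition pref_accepts :: "nfa \<Rightarrow> nat list \<Rightarrow> bool" where
  "pref_accepts A u \<longleftrightarrow> (\<exists>p\<in>set (nfa_run A u). p \<in> set (nfa_coreach A))"

lemma set_nfa_step: "set (nfa_step A S a) = {q. \<exists>p\<in>set S. (p, a, q) \<in> set (snd (snd A))}"
  unfolding nfa_step_def by force

lemma set_nfa_run:
  "set (nfa_run A u) = {q. \<exists>p\<in>set (fst A). nfa_reach (snd (snd A)) p u q}"
proof (induction u rule: rev_induct)
  case (snoc a u)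
  have "nfa_run A (u @ [a]) = nfa_step A (nfa_run A u) a"
    by (simp add: nfa_run_def)
  with snoc show ?case
    by (auto simp: set_nfa_step nfa_reach_append)
qed (auto simp: nfa_run_def)

lemma set_nfa_run_append:
  assumes "set (nfa_run A u) = set (nfa_run A v)"
  shows "set (nfa_run A (u @ w)) = set (nfa_run A (v @ w))"
proof -
  have "set (nfa_run A (u @ w)) = {q. \<exists>r\<in>set (nfa_run A u). nfa_reach (snd (snd A)) r w q}" for u
    unfolding set_nfa_run by (auto simp: nfa_reach_append)
  with assms show ?thesis by simp
qed

lemma finite_range_nfa_run: "finite (range (\<lambda>u. set (nfa_run A u)))"
proof (rule finite_subset)
  have "set (nfa_run A u) \<subseteq> set (fst A) \<union> (\<lambda>e. snd (snd e)) ` set (snd (snd A))" for u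
  proof (cases u rule: rev_cases)
    case (snoc v a)
    then show ?thesis
      by (auto simp: nfa_run_def nfa_step_def)
  qed (simp add: nfa_run_def)
  then show "range (\<lambda>u. set (nfa_run A u)) \<subseteq> Pow (set (fst A) \<union> (\<lambda>e. snd (snd e)) ` set (snd (snd A)))"
    by blast
qed simp

lemma set_nfa_pre: "set (nfa_pre A R) = set R \<union> {p. \<exists>a q. (p, a, q) \<in> set (snd (snd A)) \<and> q \<in> set R}"
  unfolding nfa_pre_def by force

lemma set_nfa_coreach:
  "set (nfa_coreach A) = {p. \<exists>v. \<exists>q\<in>set (fst (snd A)). nfa_reach (snd (snd A)) p v q}"
proof -
  let ?T = "snd (snd A)" and ?F = "fst (snd A)"
  define R where "R k = (nfa_pre A ^^ k) ?F" for k
  have foldl_const: "foldl (\<lambda>R _. g R) a l = (g ^^ length l) a" for g :: "'x \<Rightarrow> 'x" and a and l :: "'y list"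
    by (induction l arbitrary: a) (auto simp: funpow_swap1)
  have coreach: "nfa_coreach A = R (length ?T)"
    by (simp add: nfa_coreach_def R_def foldl_const)
  have Suc_R: "set (R (Suc k)) = set (R k) \<union> {p. \<exists>a q. (p, a, q) \<in> set ?T \<and> q \<in> set (R k)}" for k
    by (simp add: R_def set_nfa_pre)
  have sound: "\<exists>v. \<exists>q\<in>set ?F. nfa_reach ?T p v q" if "p \<in> set (R k)" for p k
    using that
  proof (induction k arbitrary: p)
    case 0
    then show ?case
      by (intro exI[of _ "[]"]) (simp add: R_def)
  next
    case (Suc k)
    show ?case
    proof (cases "p \<in> set (R k)")
      case False
      then obtain a q where "(p, a, q) \<in> set ?T" "q \<in> set (R k)"
        using Suc.prems unfolding Suc_R by blast
      then show ?thesis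
        using Suc.IH[of q] by (metis nfa_reach.simps(2))
    qed (use Suc.IH in blast)
  qed
  have "\<exists>k\<le>length ?T. set (R (Suc k)) = set (R k)"
  proof (rule ccontr)
    assume neq: "\<not> (\<exists>k\<le>length ?T. set (R (Suc k)) = set (R k))"
    \<comment> \<open>Without stabilisation each round adds a state outside the final ones, while
      all added states are sources of transitions; one round more than there are transitions is too
      many.\<close>
    have "k \<le> card (set (R k) - set ?F) \<and> set ?F \<subseteq> set (R k)" if "k \<le> Suc (length ?T)" for k
      using that
    proof (induction k)
      case 0
      then show ?case by (simp add: R_def)
    next
      case (Suc k)
      then have "set (R k) \<subset> set (R (Suc k))"
        using neq Suc_R[of k] by auto
      then have "set (R k) - set ?F \<subset> set (R (Suc k)) - set ?F"
        using Suc by auto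
      then have "card (set (R k) - set ?F) < card (set (R (Suc k)) - set ?F)"
        by (intro psubset_card_mono) auto
      with Suc show ?case
        using Suc_R[of k] by auto
    qed
    from this[of "Suc (length ?T)"] have "length ?T < card (set (R (Suc (length ?T))) - set ?F)"
      by simp
    also have "\<dots> \<le> card (fst ` set ?T)"
    proof (rule card_mono)
      have "set (R k) \<subseteq> set ?F \<union> fst ` set ?T" for k
        by (induction k) (use Suc_R in \<open>force simp: R_def\<close>)+
      then show "set (R (Suc (length ?T))) - set ?F \<subseteq> fst ` set ?T"
        by blast
    qed simp
    also have "\<dots> \<le> length ?T"
      by (meson card_image_le card_length finite_set le_trans)
    finally show False by simp
  qed
  then obtain k where k: "k \<le> length ?T" "set (R (Suc k)) = set (R k)"
    by blast
  have stable: "set (R (k + m)) = set (R k)" for m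
    by (induction m) (use k(2) Suc_R in auto)
  have "set (nfa_coreach A) = set (R k)"
    using stable[of "length ?T - k"] k(1) by (simp add: coreach)
  moreover have "p \<in> set (R k)" if "nfa_reach ?T p v q" "q \<in> set ?F" for p v q
    using that
  proof (induction v arbitrary: p)
    case Nil
    have "set ?F \<subseteq> set (R m)" for m
      by (induction m) (use Suc_R in \<open>auto simp: R_def\<close>)
    with Nil show ?case by auto
  next
    case (Cons a v)
    then obtain p' where "(p, a, p') \<in> set ?T" "p' \<in> set (R k)"
      by auto
    then show ?case
      using k(2) Suc_R[of k] by blast
  qed
  ultimately show ?thesis
    using sound[of _ k] by auto
qed

lemma pref_accepts_iff: "pref_accepts A u \<longleftrightarrow> u \<in> Pref (nfa_lang A)"
proof -
  obtain I F T where A: "A = (I, F, T)"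
    by (cases A)
  show ?thesis
    unfolding pref_accepts_def set_nfa_run set_nfa_coreach Pref_def nfa_lang_def A
    by (auto simp: nfa_reach_append)
qed

section \<open>From machine runs to words of transitions\<close>

fun raw_act :: "act \<Rightarrow> nat \<times> nat \<times> nat" where
  "raw_act (Snd c a) = (0, c, a)"
| "raw_act (Rcv c a) = (1, c, a)"

definition raw_trans :: "nat \<times> act \<times> nat \<Rightarrow> trans" where
  "raw_trans t = (fst t, raw_act (fst (snd t)), snd (snd t))"

lemma snds_raw: "snds c [(q, raw_act b, q')] = proj_send c [b]"
  by (cases b) (auto simp: snds_def)

lemma rcvs_raw: "rcvs c [(q, raw_act b, q')] = (case b of Snd d a \<Rightarrow> [] | Rcv d a \<Rightarrow> if d = c then [a] else [])"
  by (cases b) (auto simp: rcvs_def)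

lemma proj_send_append: "proj_send c (\<sigma> @ \<tau>) = proj_send c \<sigma> @ proj_send c \<tau>"
  by (induction c \<sigma> rule: proj_send.induct) auto

text \<open>Sends on distinct channels do not affect each other's projections, so completions chosen
  channel by channel can be appended in a row. The result need not be executable, since
  \<open>L_send\<close> is a language of action words.\<close>

lemma Pref_L_send_iff:
  assumes "valid_inst M" "set \<sigma> \<subseteq> actions M"
  shows "\<sigma> \<in> Pref (L_send M) \<longleftrightarrow> (\<forall>c\<in>set (chans M). proj_send c \<sigma> \<in> Pref (L_c M c))"
proof
  assume "\<sigma> \<in> Pref (L_send M)"
  then show "\<forall>c\<in>set (chans M). proj_send c \<sigma> \<in> Pref (L_c M c)"
    unfolding Pref_def L_send_def by (auto simp: proj_send_append)
next
  assume "\<forall>c\<in>set (chans M). proj_send c \<sigma> \<in> Pref (L_c M c)"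
  then obtain v where v: "\<And>c. c \<in> set (chans M) \<Longrightarrow> proj_send c \<sigma> @ v c \<in> L_c M c"
    unfolding Pref_def by (auto simp: bchoice_iff)
  define \<tau> where "\<tau> cs = concat (map (\<lambda>c. map (Snd c) (v c)) cs)" for cs
  have self: "proj_send c (map (Snd c) u) = u" for c u
    by (induction u) auto
  have other: "proj_send c (map (Snd d) u) = []" if "d \<noteq> c" for c d u
    using that by (induction u) auto
  \<comment> \<open>The channel list may contain repetitions, which would append a completion twice;
    hence \<open>remdups\<close> below.\<close>
  have \<tau>: "distinct cs \<Longrightarrow> proj_send c (\<tau> cs) = (if c \<in> set cs then v c else [])" for c cs
    by (induction cs) (auto simp: \<tau>_def proj_send_append self other, metis other)
  have "a \<in> Sigma_c M c" if "c \<in> set (chans M)" "a \<in> set (v c)" for a c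
  proof -
    have "L_c M c \<subseteq> lists (Sigma_c M c)"
      using assms(1) that(1) unfolding valid_inst_def by blast
    then have "set (proj_send c \<sigma> @ v c) \<subseteq> Sigma_c M c"
      using v[OF that(1)] by auto
    with that(2) show ?thesis by auto
  qed
  then have "set (\<tau> (remdups (chans M))) \<subseteq> actions M"
    unfolding \<tau>_def actions_def by auto
  then have "\<sigma> @ \<tau> (remdups (chans M)) \<in> L_send M"
    unfolding L_send_def using assms(2) v \<tau>[of "remdups (chans M)"]
    by (simp add: proj_send_append)
  then show "\<sigma> \<in> Pref (L_send M)"
    unfolding Pref_def by blast
qed

text \<open>The state of the subset construction. Taking the set rather than the list discards order
  and multiplicity and gives a finite range.\<close>

definition chan_lang_state :: "fifo_inst \<Rightarrow> nat \<Rightarrow> nat list \<Rightarrow> nat set" where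
  "chan_lang_state M c u = set (nfa_run (the (map_of (auts M) c)) u)"

lemma fifo_words_inst:
  assumes "valid_inst M"
  shows "fifo_words (set (chans M)) (raw_trans ` set (delta M)) (\<lambda>c. Pref (L_c M c)) (chan_lang_state M)"
proof
  fix c u v w
  show "finite (range (chan_lang_state M c))"
    unfolding chan_lang_state_def by (rule finite_range_nfa_run)
  show "chan_lang_state M c u = chan_lang_state M c v \<Longrightarrow>
      chan_lang_state M c (u @ w) = chan_lang_state M c (v @ w)"
    unfolding chan_lang_state_def by (rule set_nfa_run_append)
  show "chan_lang_state M c u = chan_lang_state M c v \<Longrightarrow> u \<in> Pref (L_c M c) \<longleftrightarrow> v \<in> Pref (L_c M c)"
    unfolding L_c_def pref_accepts_iff[symmetric] pref_accepts_def chan_lang_state_def by simp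
  assume c: "c \<in> set (chans M)"
  then have "bounded_lang (L_c M c)" "L_c M c \<noteq> {}"
    using assms unfolding valid_inst_def by auto
  then show "\<exists>ws. (\<forall>w\<in>set ws. w \<noteq> []) \<and> Pref (L_c M c) \<subseteq> Pref (bounded_by ws)" "[] \<in> Pref (L_c M c)"
    unfolding bounded_lang_def Pref_def by auto blast
qed auto

text \<open>An infinite set of executions has an infinite branch by Koenig's lemma, and the branch
  is read back as a run of configurations. Conversely, the prefixes of an infinite run are
  infinitely many executions.\<close>

lemma IB_terminates_iff:
  assumes valid: "valid_inst M"
  shows "IB_terminates M \<longleftrightarrow> finite {\<sigma>. all_steps (fifo_words.ok (set (chans M))
    (raw_trans ` set (delta M)) (init M) (\<lambda>c. Pref (L_c M c))) \<sigma>}"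
proof -
  interpret fifo_words "set (chans M)" "raw_trans ` set (delta M)" "init M"
    "\<lambda>c. Pref (L_c M c)" "chan_lang_state M"
    by (rule fifo_words_inst[OF valid])
  have actions: "b \<in> actions M" if "(q, b, q') \<in> set (delta M)" for q b q'
    using valid that unfolding valid_inst_def by blast
  show ?thesis
  proof (intro iffI; rule ccontr)
    assume "IB_terminates M" and inf: "infinite {\<sigma>. exec \<sigma>}"
    obtain f where f: "\<And>n. exec (map f [0..<n])"
      using infinite_branch[OF inf] by blast
    define P where "P n = map f [0..<n]" for n
    have exec_P: "exec (P n)" for n
      using f by (simp add: P_def)
    have P_Suc: "P (Suc n) = P n @ [f n]" for n
      by (simp add: P_def)
    have okf: "ok (P n) (f n)" for n
      using exec_P[of "Suc n"] by (simp add: P_Suc)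
    have "\<exists>t. t \<in> set (delta M) \<and> f n = raw_trans t" for n
      using okf[of n] unfolding ok_def by blast
    then obtain t where t: "\<And>n. t n \<in> set (delta M)" "\<And>n. f n = raw_trans (t n)"
      by metis
    define \<beta> where "\<beta> n = fst (snd (t n))" for n
    define s where "s n = (end_state (init M) (P n), \<lambda>c. content c (P n))" for n
    have tn: "t n = (end_state (init M) (P n), \<beta> n, end_state (init M) (P (Suc n)))" for n
    proof -
      have "fst (f n) = end_state (init M) (P n)"
        using okf[of n] unfolding ok_def by blast
      then have "fst (t n) = end_state (init M) (P n)"
        by (simp add: t(2) raw_trans_def)
      moreover have "end_state (init M) (P (Suc n)) = snd (snd (t n))"
        by (simp add: P_Suc t(2) end_state_def raw_trans_def)
      ultimately show ?thesis
        by (simp add: \<beta>_def prod_eq_iff)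
    qed
    then have \<beta>: "\<beta> n \<in> actions M" for n
      using t(1)[of n] actions by metis
    have fn: "f n = (end_state (init M) (P n), raw_act (\<beta> n), end_state (init M) (P (Suc n)))" for n
      using t(2)[of n] tn[of n] by (simp add: raw_trans_def)
    have snds_P: "snds c (P n) = proj_send c (map \<beta> [0..<n])" for c n
    proof (induction n)
      case (Suc n)
      then show ?case
        unfolding P_Suc by (simp add: fn snds_raw proj_send_append)
    qed (simp add: P_def)
    have snds_step: "snds c (P (Suc n)) = snds c (P n) @ proj_send c [\<beta> n]"
      and rcvs_step: "rcvs c (P (Suc n)) = rcvs c (P n) @
        (case \<beta> n of Snd d a \<Rightarrow> [] | Rcv d a \<Rightarrow> if d = c then [a] else [])" for c n
      unfolding P_Suc by (simp_all add: fn snds_raw rcvs_raw)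
    have step: "fstep M (s n) (\<beta> n) (s (Suc n))" for n
    proof (cases "\<beta> n")
      case (Snd c a)
      then have c: "c \<in> set (chans M)"
        using \<beta>[of n] by (auto simp: actions_def)
      \<comment> \<open>The received word is no longer than the sent one, so dropping its length
        commutes with appending a message.\<close>
      have "content d (P (Suc n)) = ((\<lambda>c. content c (P n))(c := content c (P n) @ [a])) d" for d
        using prefix_length_le[OF exec_prefix[OF exec_P[of n] c]]
        unfolding content_def by (simp add: snds_step rcvs_step Snd)
      then show ?thesis
        using t(1)[of n] tn[of n] unfolding s_def by (auto simp: Snd)
    next
      case (Rcv c a)
      then have c: "c \<in> set (chans M)"
        using \<beta>[of n] by (auto simp: actions_def)
      have eqs: "snds d (P (Suc n)) = snds d (P n)"
        "rcvs d (P (Suc n)) = rcvs d (P n) @ (if c = d then [a] else [])" for d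
        by (simp_all add: snds_step rcvs_step Rcv)
      have other: "content d (P (Suc n)) = content d (P n)" if "d \<noteq> c" for d
        using that by (simp add: content_def eqs)
      have "rcvs c (P n) @ content c (P n) = rcvs c (P n) @ [a] @ content c (P (Suc n))"
        using exec_content[OF exec_P[of n] c] exec_content[OF exec_P[of "Suc n"] c] by (simp add: eqs)
      then have "content c (P n) = a # content c (P (Suc n))"
        by simp
      moreover have "(\<lambda>c. content c (P (Suc n))) = (\<lambda>c. content c (P n))(c := content c (P (Suc n)))"
        using other by auto
      ultimately show ?thesis
        using t(1)[of n] tn[of n] unfolding s_def by (simp add: Rcv)
    qed
    have "map \<beta> [0..<Suc n] \<in> Pref (L_send M)" for n
    proof (subst Pref_L_send_iff[OF valid])
      show "set (map \<beta> [0..<Suc n]) \<subseteq> actions M"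
        using \<beta> by auto
      show "\<forall>c\<in>set (chans M). proj_send c (map \<beta> [0..<Suc n]) \<in> Pref (L_c M c)"
        unfolding snds_P[symmetric] using exec_K[OF exec_P] by blast
    qed
    moreover have "s 0 = init_config M"
      by (simp add: s_def P_def init_config_def content_def)
    ultimately have "\<not> IB_terminates M"
      unfolding IB_terminates_def using \<beta> step by blast
    with \<open>IB_terminates M\<close> show False by simp
  next
    assume fin: "finite {\<sigma>. exec \<sigma>}" and "\<not> IB_terminates M"
    then obtain s \<beta> where s0: "s 0 = init_config M" and \<beta>: "\<And>i. \<beta> i \<in> actions M"
      and step: "\<And>i. fstep M (s i) (\<beta> i) (s (Suc i))"
      and pref: "\<And>i. map \<beta> [0..<Suc i] \<in> Pref (L_send M)"
      unfolding IB_terminates_def by blast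
    define f where "f i = (fst (s i), raw_act (\<beta> i), fst (s (Suc i)))" for i
    define P where "P n = map f [0..<n]" for n
    have P_Suc: "P (Suc n) = P n @ [f n]" for n
      by (simp add: P_def)
    have end_P: "end_state (init M) (P n) = fst (s n)" for n
      by (cases n) (simp_all add: P_def s0 init_config_def end_state_def f_def)
    have snds_P: "snds c (P n) = proj_send c (map \<beta> [0..<n])" for c n
    proof (induction n)
      case (Suc n)
      then show ?case
        unfolding P_Suc by (simp add: f_def snds_raw proj_send_append)
    qed (simp add: P_def)
    \<comment> \<open>The first-in-first-out invariant; it supplies the prefix condition of
      \<open>ok\<close> at every moment.\<close>
    have queue: "snds c (P n) = rcvs c (P n) @ snd (s n) c" for c n
    proof (induction n arbitrary: c)
      case 0
      then show ?case by (simp add: P_def s0 init_config_def)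
    next
      case (Suc n)
      obtain q w q' w' where s: "s n = (q, w)" "s (Suc n) = (q', w')"
        by (meson surj_pair)
      have snds_step: "snds c (P (Suc n)) = snds c (P n) @ proj_send c [\<beta> n]"
        and rcvs_step: "rcvs c (P (Suc n)) = rcvs c (P n) @
          (case \<beta> n of Snd d a \<Rightarrow> [] | Rcv d a \<Rightarrow> if d = c then [a] else [])"
        unfolding P_Suc by (simp_all add: f_def snds_raw rcvs_raw)
      show ?case
      proof (cases "\<beta> n")
        case (Snd d a)
        then show ?thesis
          using step[of n] Suc[of c] by (auto simp: snds_step rcvs_step s)
      next
        case (Rcv d a)
        then have "w d = a # w' d" and w': "w' = w(d := w' d)"
          using step[of n] by (auto simp: s)
        moreover have "w' c = w c" if "d \<noteq> c"
          using fun_cong[OF w', of c] that by simp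
        ultimately show ?thesis
          using Suc[of c] Rcv by (auto simp: snds_step rcvs_step s)
      qed
    qed
    have "exec (P n)" for n
    proof (induction n)
      case (Suc n)
      have "(fst (s n), \<beta> n, fst (s (Suc n))) \<in> set (delta M)"
        using step[of n] by (cases "\<beta> n"; cases "s n"; cases "s (Suc n)") auto
      then have "f n \<in> raw_trans ` set (delta M)"
        unfolding f_def by (force simp: raw_trans_def)
      moreover have "snds c (P (Suc n)) \<in> Pref (L_c M c)" if "c \<in> set (chans M)" for c
      proof -
        have "set (map \<beta> [0..<Suc n]) \<subseteq> actions M"
          using \<beta> by auto
        then show ?thesis
          using pref[of n] Pref_L_send_iff[OF valid] that unfolding snds_P by blast
      qed
      moreover have "prefix (rcvs c (P (Suc n))) (snds c (P (Suc n)))" for c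
        unfolding queue[of c "Suc n"] by simp
      ultimately have "ok (P n) (f n)"
        unfolding ok_def P_Suc[symmetric] end_P by (simp add: f_def)
      with Suc show ?case
        by (simp add: P_Suc)
    qed (simp add: P_def)
    then have "range P \<subseteq> {\<sigma>. exec \<sigma>}"
      by blast
    moreover have "inj P"
      by (rule inj_on_inverseI[of _ length]) (simp add: P_def)
    ultimately show False
      using fin finite_subset infinite_UNIV_nat finite_imageD by blast
  qed
qed

section \<open>The decision procedure\<close>

type_synonym raw_inst = "nat list \<times> trans list \<times> nat \<times> (nat \<times> nfa) list"

definition raw_inst :: "fifo_inst \<Rightarrow> raw_inst" where
  "raw_inst M = (chans M, map raw_trans (delta M), init M, auts M)"

text \<open>In the reversed list the first entry for \<open>c\<close> is met last and overrides the
  others, as in \<open>map_of\<close>. The default is an automaton without states, so that the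
  lookup is total.\<close>

definition raw_lookup :: "(nat \<times> nfa) list \<Rightarrow> nat \<Rightarrow> nfa" where
  "raw_lookup As c = foldl (\<lambda>B e. if fst e = c then snd e else B) ([], [], []) (rev As)"

definition raw_ok :: "raw_inst \<Rightarrow> trans list \<Rightarrow> trans \<Rightarrow> bool" where
  "raw_ok I \<sigma> t \<longleftrightarrow> t \<in> set (fst (snd I)) \<and> fst t = end_state (fst (snd (snd I))) \<sigma> \<and>
    (\<forall>c\<in>set (fst I). prefix (rcvs c (\<sigma> @ [t])) (snds c (\<sigma> @ [t])) \<and>
      pref_accepts (raw_lookup (snd (snd (snd I))) c) (snds c (\<sigma> @ [t])))"

definition raw_lasso :: "raw_inst \<Rightarrow> trans list \<Rightarrow> trans list \<Rightarrow> bool" where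
  "raw_lasso I \<sigma> \<tau> \<longleftrightarrow> \<tau> \<noteq> [] \<and> all_steps (raw_ok I) (\<sigma> @ \<tau>) \<and>
    end_state (fst (snd (snd I))) (\<sigma> @ \<tau>) = end_state (fst (snd (snd I))) \<sigma> \<and>
    (\<forall>c\<in>set (fst I).
      set (nfa_run (raw_lookup (snd (snd (snd I))) c) (snds c (\<sigma> @ \<tau>)))
        = set (nfa_run (raw_lookup (snd (snd (snd I))) c) (snds c \<sigma>)) \<and>
      (rcvs c \<tau> = [] \<or> pumpable (content c \<sigma>) (content c (\<sigma> @ \<tau>)) (snds c \<tau>)))"

definition closed_words :: "raw_inst \<Rightarrow> trans list list \<Rightarrow> bool" where
  "closed_words I X \<longleftrightarrow> [] \<in> set X \<and>
    (\<forall>\<sigma>\<in>set X. \<forall>t\<in>set (fst (snd I)). raw_ok I \<sigma> t \<longrightarrow> \<sigma> @ [t] \<in> set X)"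

section \<open>Computability of the certificate checks\<close>

lemma computable_snds [computable_intros]:
  assumes "computable f" "computable g" shows "computable (\<lambda>x. snds (f x) (g x))"
proof -
  have "computable (\<lambda>p. snds (fst p) (snd p))"
    unfolding snds_def by (intro computable_intros)
  from computable_comp2[OF this assms] show ?thesis .
qed

lemma computable_rcvs [computable_intros]:
  assumes "computable f" "computable g" shows "computable (\<lambda>x. rcvs (f x) (g x))"
proof -
  have "computable (\<lambda>p. rcvs (fst p) (snd p))"
    unfolding rcvs_def by (intro computable_intros)
  from computable_comp2[OF this assms] show ?thesis .
qed

lemma computable_end_state [computable_intros]:
  assumes "computable f" "computable g" shows "computable (\<lambda>x. end_state (f x) (g x))"
proof -
  have "computable (\<lambda>p. end_state (fst p) (snd p))"
    unfolding end_state_def by (intro computable_intros)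
  from computable_comp2[OF this assms] show ?thesis .
qed

lemma computable_content [computable_intros]:
  assumes "computable f" "computable g" shows "computable (\<lambda>x. content (f x) (g x))"
  unfolding content_def by (intro computable_intros assms)

lemma computable_nfa_run [computable_intros]:
  assumes "computable f" "computable g" shows "computable (\<lambda>x. nfa_run (f x) (g x))"
proof -
  have "computable (\<lambda>p. nfa_run (fst p) (snd p))"
    unfolding nfa_run_def nfa_step_def by (intro computable_intros)
  from computable_comp2[OF this assms] show ?thesis .
qed

lemma computable_nfa_coreach [computable_intros]:
  assumes "computable f" shows "computable (\<lambda>x. nfa_coreach (f x))"
proof -
  have "computable (\<lambda>A. nfa_coreach A)"
    unfolding nfa_coreach_def nfa_pre_def by (intro computable_intros)
  from computable_comp[OF this assms] show ?thesis .
qed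

lemma computable_pref_accepts [computable_intros]:
  assumes "computable f" "computable g" shows "computable (\<lambda>x. pref_accepts (f x) (g x))"
proof -
  have "computable (\<lambda>p. pref_accepts (fst p) (snd p))"
    unfolding pref_accepts_def by (intro computable_intros)
  from computable_comp2[OF this assms] show ?thesis .
qed

lemma computable_raw_lookup [computable_intros]:
  assumes "computable f" "computable g" shows "computable (\<lambda>x. raw_lookup (f x) (g x))"
proof -
  have "computable (\<lambda>p. raw_lookup (fst p) (snd p))"
    unfolding raw_lookup_def by (intro computable_intros)
  from computable_comp2[OF this assms] show ?thesis .
qed

text \<open>The suffix \<open>x\<close> is determined by the two contents, so the existential
  quantifier becomes a direct test.\<close>

lemma pumpable_iff:
  "pumpable w w' s \<longleftrightarrow> prefix w w' \<and> drop (length w) w' @ s = s @ drop (length w) w'"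
  unfolding pumpable_def by (auto simp: prefix_def)

lemma computable_pumpable [computable_intros]:
  "computable f \<Longrightarrow> computable g \<Longrightarrow> computable h \<Longrightarrow> computable (\<lambda>x. pumpable (f x) (g x) (h x))"
  unfolding pumpable_iff by (intro computable_intros)

lemma computable_raw_ok [computable_intros]:
  assumes "computable f" "computable g" "computable h"
  shows "computable (\<lambda>x. raw_ok (f x) (g x) (h x))"
proof -
  have "computable (\<lambda>p. raw_ok (fst p) (fst (snd p)) (snd (snd p)))"
    unfolding raw_ok_def by (intro computable_intros)
  from computable_comp3[OF this assms] show ?thesis .
qed

lemma computable_all_steps_raw_ok [computable_intros]:
  assumes "computable f" "computable g"
  shows "computable (\<lambda>x. all_steps (raw_ok (f x)) (g x))"
proof -
  have "computable (\<lambda>p. all_steps (raw_ok (fst p)) (snd p))"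
    unfolding all_steps_def by (intro computable_intros)
  from computable_comp2[OF this assms] show ?thesis .
qed

lemma computable_raw_lasso [computable_intros]:
  assumes "computable f" "computable g" "computable h"
  shows "computable (\<lambda>x. raw_lasso (f x) (g x) (h x))"
proof -
  have "computable (\<lambda>p. raw_lasso (fst p) (fst (snd p)) (snd (snd p)))"
    unfolding raw_lasso_def by (intro computable_intros)
  from computable_comp3[OF this assms] show ?thesis .
qed

lemma computable_closed_words [computable_intros]:
  assumes "computable f" "computable g" shows "computable (\<lambda>x. closed_words (f x) (g x))"
proof -
  have "computable (\<lambda>p. closed_words (fst p) (snd p))"
    unfolding closed_words_def by (intro computable_intros)
  from computable_comp2[OF this assms] show ?thesis .
qed

section \<open>Correctness of the certificate checks\<close>

lemma raw_lookup_eq: "map_of As c \<noteq> None \<Longrightarrow> raw_lookup As c = the (map_of As c)"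
  by (induction As) (auto simp: raw_lookup_def)

lemma raw_ok_eq:
  assumes "valid_inst M"
  shows "raw_ok (raw_inst M) = fifo_words.ok (set (chans M)) (raw_trans ` set (delta M)) (init M)
    (\<lambda>c. Pref (L_c M c))"
proof -
  have "map_of (auts M) c \<noteq> None" if "c \<in> set (chans M)" for c
    using assms that unfolding valid_inst_def by blast
  then show ?thesis
    unfolding fun_eq_iff raw_ok_def fifo_words.ok_def[OF fifo_words_inst[OF assms]]
    by (auto simp: raw_inst_def raw_lookup_eq pref_accepts_iff L_c_def)
qed

lemma raw_lasso_eq:
  assumes "valid_inst M"
  shows "raw_lasso (raw_inst M) = fifo_words.lasso (set (chans M)) (raw_trans ` set (delta M)) (init M)
    (\<lambda>c. Pref (L_c M c)) (chan_lang_state M)"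
proof -
  have "map_of (auts M) c \<noteq> None" if "c \<in> set (chans M)" for c
    using assms that unfolding valid_inst_def by blast
  then show ?thesis
    unfolding fun_eq_iff raw_lasso_def fifo_words.lasso_def[OF fifo_words_inst[OF assms]] raw_ok_eq[OF assms]
    by (auto simp: raw_inst_def raw_lookup_eq chan_lang_state_def)
qed

text \<open>By induction on its length every execution lies in \<open>X\<close>; the list may
  contain other words as well, so it need not be the exact set.\<close>

lemma closed_words_imp_finite:
  assumes "closed_words I X" shows "finite {\<sigma>. all_steps (raw_ok I) \<sigma>}"
proof (rule finite_subset)
  have "\<sigma> \<in> set X" if "all_steps (raw_ok I) \<sigma>" for \<sigma>
    using that
  proof (induction \<sigma> rule: rev_induct)
    case (snoc t \<sigma>)
    then show ?case
      using assms unfolding closed_words_def by (auto simp: raw_ok_def)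
  qed (use assms in \<open>simp add: closed_words_def\<close>)
  then show "{\<sigma>. all_steps (raw_ok I) \<sigma>} \<subseteq> set X"
    by blast
qed simp

lemma finite_imp_closed_words:
  assumes "finite {\<sigma>. all_steps (raw_ok I) \<sigma>}" shows "\<exists>X. closed_words I X"
proof -
  obtain X where "set X = {\<sigma>. all_steps (raw_ok I) \<sigma>}"
    using finite_list[OF assms] by blast
  then show ?thesis
    unfolding closed_words_def by (intro exI[of _ X]) simp
qed

section \<open>Agreement with the prescribed encoding of instances\<close>

lemma encode_nfa: "encode A = enc_nfa A"
  by (cases A) (auto simp: enc_nfa_def encode_list_def encode_nat_def enc_triple_def
      map_idI intro!: arg_cong[of _ _ list_encode])

lemma encode_raw_trans: "encode (raw_trans (q, b, q')) = enc_triple (q, enc_act b, q')"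
  by (cases b) (simp_all add: raw_trans_def enc_triple_def encode_nat_def)

lemma encode_nat_list: "encode (xs :: nat list) = list_encode xs"
  by (simp add: encode_list_def encode_nat_def map_idI)

text \<open>Head and tail on list codes, a non-empty list being coded by the successor of a pair.
  Counting from 0, the entries 1, 3, 4 and 5 of the instance are selected: channels, transitions,
  initial state and automata.\<close>

definition raw_code :: "nat \<Rightarrow> nat" where
  "raw_code z = (let hd = (\<lambda>z. pfst (z - 1)); tl = (\<lambda>z. psnd (z - 1)); z1 = tl z; z3 = tl (tl z1) in
     prod_encode (hd z1, prod_encode (hd z3, prod_encode (hd (tl z3), hd (tl (tl z3))))))"

lemma raw_code_enc_inst: "raw_code (enc_inst M) = encode (raw_inst M)"
proof -
  have delta: "map (\<lambda>(q, b, q'). enc_triple (q, enc_act b, q')) (delta M) = map encode (map raw_trans (delta M))"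
    by (auto simp: encode_raw_trans)
  have auts: "map (\<lambda>(c, A). prod_encode (c, enc_nfa A)) (auts M) = map encode (auts M)"
    by (auto simp: encode_nfa encode_nat_def)
  show ?thesis
    unfolding enc_inst_def raw_code_def Let_def raw_inst_def delta auts
    by (simp add: encode_nat_list del: map_map) (simp add: encode_list_def encode_nat_def)
qed

theorem theorem5p11:
  shows "decidable_on enc_inst valid_inst IB_terminates"
proof (rule decidable_on_by_search)
  \<comment> \<open>A candidate holds a list of words together with a possible lasso. The answer
    looks only at the list, because a closed list and a lasso cannot both exist for one valid
    machine.\<close>
  let ?A = "\<lambda>p :: raw_inst \<times> trans list list \<times> trans list \<times> trans list. closed_words (fst p) (fst (snd p))"
  let ?Q = "\<lambda>p. ?A p \<or> raw_lasso (fst p) (fst (snd (snd p))) (snd (snd (snd p)))"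
  show "computable ?Q" "computable ?A"
    by (intro computable_intros)+
  show "surj (encode :: trans list list \<times> trans list \<times> trans list \<Rightarrow> nat)"
    by (intro surj_encode_prod surj_encode_list surj_encode_nat)
  show "recn 1 (\<lambda>xs. raw_code (xs ! 0))"
    unfolding raw_code_def Let_def by (intro recn_intros) auto
  show "raw_code ([enc_inst M] ! 0) = encode (raw_inst M)" for M
    by (simp add: raw_code_enc_inst)
  fix M assume valid: "valid_inst M"
  interpret fifo_words "set (chans M)" "raw_trans ` set (delta M)" "init M"
    "\<lambda>c. Pref (L_c M c)" "chan_lang_state M"
    by (rule fifo_words_inst[OF valid])
  have term_iff: "IB_terminates M \<longleftrightarrow> finite {\<sigma>. all_steps (raw_ok (raw_inst M)) \<sigma>}"
    unfolding raw_ok_eq[OF valid] by (rule IB_terminates_iff[OF valid])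
  have lasso: "\<not> IB_terminates M" if "raw_lasso (raw_inst M) \<sigma> \<tau>" for \<sigma> \<tau>
    using lasso_infinite that unfolding raw_lasso_eq[OF valid] IB_terminates_iff[OF valid] by blast
  show "\<exists>y. ?Q (raw_inst M, y)"
  proof (cases "IB_terminates M")
    case True
    then show ?thesis
      using finite_imp_closed_words term_iff by fastforce
  next
    case False
    then obtain \<sigma> \<tau> where "raw_lasso (raw_inst M) \<sigma> \<tau>"
      using infinite_imp_lasso unfolding raw_lasso_eq[OF valid] IB_terminates_iff[OF valid] by blast
    then show ?thesis
      \<comment> \<open>The empty list is a placeholder: the lasso alone makes the candidate
        acceptable.\<close>
      by (intro exI[of _ "([], \<sigma>, \<tau>)"]) simp
  qed
  fix y
  assume "?Q (raw_inst M, y)"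
  then show "?A (raw_inst M, y) \<longleftrightarrow> IB_terminates M"
    using lasso closed_words_imp_finite term_iff by fastforce
qed

end
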